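(* Let $n\ge 2$ and let $G\subset\mathbb{R}^n$ be an open connected set. Let $b=(b_1,\dots,b_n):G\to\mathbb{R}^n$, where each drift coefficient $b_i$ is continuous and bounded in $G$. Suppose $u\in C^2(G)$ is a real-valued solution to $$\Delta u = b(x)\cdot\nabla u \quad\text{in } G.$$ If there is a nonempty open set $D\subset G$ such that $u=0$ in $D$, then $u\equiv 0$ in $G$. *)

theory Defs
  imports "HOL-Analysis.Analysis"
begin

(* Functions on an open set G are represented by total functions on real^'n. At a point of G
   the partial derivatives depend only on the values near that point, hence only on values in G. *)

definition partial_differentiable :: "'n \<Rightarrow> (real^'n \<Rightarrow> real) \<Rightarrow> real^'n \<Rightarrow> bool"
  where "partial_differentiable i f x \<longleftrightarrow> (\<lambda>t::real. f (x + t *\<^sub>R axis i 1)) differentiable (at 0)"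

(* Meaningful only where partial_differentiable i f x holds. *)
definition partial_deriv :: "'n \<Rightarrow> (real^'n \<Rightarrow> real) \<Rightarrow> real^'n \<Rightarrow> real"
  where "partial_deriv i f x = deriv (\<lambda>t::real. f (x + t *\<^sub>R axis i 1)) 0"

definition C1_on :: "(real^'n) set \<Rightarrow> (real^'n \<Rightarrow> real) \<Rightarrow> bool"
  where "C1_on G f \<longleftrightarrow> continuous_on G f \<and>
    (\<forall>i. (\<forall>x\<in>G. partial_differentiable i f x) \<and> continuous_on G (partial_deriv i f))"

definition C2_on :: "(real^'n) set \<Rightarrow> (real^'n \<Rightarrow> real) \<Rightarrow> bool"
  where "C2_on G f \<longleftrightarrow> C1_on G f \<and> (\<forall>i. C1_on G (partial_deriv i f))"

definition gradient :: "(real^'n \<Rightarrow> real) \<Rightarrow> real^'n \<Rightarrow> real^'n"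
  where "gradient f x = (\<chi> i. partial_deriv i f x)"

definition laplacian :: "(real^'n \<Rightarrow> real) \<Rightarrow> real^'n \<Rightarrow> real"
  where "laplacian f x = (\<Sum>i\<in>UNIV. partial_deriv i (partial_deriv i f) x)"

end

theory Submission
  imports Defs
begin

text \<open>
  The equation gives the differential inequality \<open>\<bar>\<Delta> u\<bar> \<le> M \<bar>\<nabla> u\<bar>\<close>, and solutions of such an
  inequality that vanish near a point are propagated by a Carleman estimate, in which the weight
  carries a large parameter \<open>\<tau>\<close> and the lower order terms become negligible.

  Write \<open>\<rho> = \<bar>x - p\<bar>\<^sup>2\<close>, let \<open>E = (x - p) \<bullet> \<nabla>\<close> be the Euler field and \<open>n\<close> the dimension. The weight
  is \<open>e\<^bsup>2\<tau>/\<rho>\<^esup>\<close>, which decreases as one moves away from \<open>p\<close>. For a compactly supported \<open>v\<close> that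
  vanishes near \<open>p\<close> put \<open>w = e\<^bsup>\<tau>/\<rho>\<^esup> v\<close>; then
  \<open>e\<^bsup>\<tau>/\<rho>\<^esup> \<Delta> v = S + A + 8 \<tau> w / \<rho>\<^sup>2\<close> with \<open>S = \<Delta> w + 4 \<tau>\<^sup>2 w / \<rho>\<^sup>3\<close> and
  \<open>A = (4 \<tau> / \<rho>\<^sup>2) (E w - (4 - n/2) w)\<close>.
  The product \<open>2 S A\<close> is, up to a divergence, the positive quantity
  \<open>8 \<tau> (4 (E w)\<^sup>2 / \<rho>\<^sup>3 + \<bar>\<nabla> w\<bar>\<^sup>2 / \<rho>\<^sup>2) + 32 \<tau>\<^sup>3 w\<^sup>2 / \<rho>\<^sup>5\<close> plus a term in \<open>\<tau> w\<^sup>2\<close>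
  (lemma \<open>carleman_field\<close>), and \<open>2 S A \<le> (S + A)\<^sup>2\<close>. Divergences of compactly supported fields
  integrate to zero, so for large \<open>\<tau>\<close> the integral of
  \<open>e\<^bsup>2\<tau>/\<rho>\<^esup> (\<tau> \<bar>\<nabla> v\<bar>\<^sup>2 / \<rho>\<^sup>2 + 8 \<tau>\<^sup>3 v\<^sup>2 / \<rho>\<^sup>5)\<close> is at most twice that of
  \<open>e\<^bsup>2\<tau>/\<rho>\<^esup> (\<Delta> v)\<^sup>2\<close> (theorem \<open>carleman_estimate\<close>).

  If \<open>u\<close> vanishes near \<open>p\<close>, apply this to \<open>v = max 0 (R\<^sup>2 - \<rho>)\<^sup>3 u\<close>. On \<open>\<rho> \<le> s < R\<^sup>2\<close>
  the differential inequality passes to \<open>v\<close> and its right-hand side is absorbed; on \<open>\<rho> > s\<close> the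
  function \<open>\<Delta> v\<close> is bounded and the weight is smaller than \<open>e\<^bsup>2\<tau>/s\<^esup>\<close>. Letting \<open>\<tau> \<longlonglongrightarrow> \<infinity>\<close> forces
  \<open>v = 0\<close> on \<open>\<rho> \<le> s\<close> (lemma \<open>sublevel_integral_eq_0\<close>). So \<open>u\<close> vanishes on every ball around \<open>p\<close> whose
  closure lies in the domain (lemma \<open>zero_near_center_imp_zero_on_ball\<close>): the interior of the zero
  set is relatively closed, and connectedness finishes the proof.
\<close>

section \<open>Partial derivatives of \<open>C\<^sup>1\<close> and \<open>C\<^sup>2\<close> functions\<close>

text \<open>A relational form of \<open>partial_deriv\<close>, so that the rules of one-variable calculus compose.\<close>

definition has_partial :: "'n \<Rightarrow> (real^'n \<Rightarrow> real) \<Rightarrow> real \<Rightarrow> real^'n \<Rightarrow> bool"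
  where "has_partial i f d x \<longleftrightarrow>
    ((\<lambda>t::real. f (x + t *\<^sub>R axis i 1)) has_real_derivative d) (at 0)"

lemma has_partial_eq_rhs: "has_partial i f d x \<Longrightarrow> d = d' \<Longrightarrow> has_partial i f d' x"
  by simp

lemma partial_deriv_eqI: "has_partial i f d x \<Longrightarrow> partial_deriv i f x = d"
  by (simp add: has_partial_def partial_deriv_def DERIV_imp_deriv)

lemma partial_differentiable_iff_has_partial:
  "partial_differentiable i f x \<longleftrightarrow> has_partial i f (partial_deriv i f x) x"
  by (simp add: has_partial_def partial_deriv_def partial_differentiable_def
      DERIV_deriv_iff_real_differentiable)

lemma has_partial_along_line:
  assumes "has_partial i f d (x + s *\<^sub>R axis i 1)"
  shows "((\<lambda>t. f (x + t *\<^sub>R axis i 1)) has_real_derivative d) (at s)"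
proof -
  have "((\<lambda>t. f (x + (t + s) *\<^sub>R axis i 1)) has_real_derivative d) (at 0)"
    using assms by (simp add: has_partial_def algebra_simps)
  then show ?thesis
    using DERIV_shift[of "\<lambda>t. f (x + t *\<^sub>R axis i 1)" d 0 s] by simp
qed

lemma has_partial_const: "has_partial i (\<lambda>x. c) 0 x"
  by (simp add: has_partial_def)

lemma has_partial_add:
  "has_partial i f d x \<Longrightarrow> has_partial i g e x \<Longrightarrow> has_partial i (\<lambda>x. f x + g x) (d + e) x"
  unfolding has_partial_def by (rule DERIV_add)

lemma has_partial_mult:
  "has_partial i f d x \<Longrightarrow> has_partial i g e x \<Longrightarrow>
    has_partial i (\<lambda>x. f x * g x) (d * g x + e * f x) x"
  unfolding has_partial_def by (drule (1) DERIV_mult) simp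

lemma has_partial_diff:
  "has_partial i f d x \<Longrightarrow> has_partial i g e x \<Longrightarrow> has_partial i (\<lambda>x. f x - g x) (d - e) x"
  unfolding has_partial_def by (rule DERIV_diff)

lemma has_partial_compose:
  assumes "(h has_real_derivative h') (at (f x))" "has_partial i f d x"
  shows "has_partial i (\<lambda>x. h (f x)) (h' * d) x"
  using assms DERIV_chain2[of h h' "\<lambda>t. f (x + t *\<^sub>R axis i 1)" 0 d UNIV]
  by (simp add: has_partial_def)

lemma has_partial_coordinate:
  "has_partial i (\<lambda>x. (x - p) $ k) (if k = i then 1 else 0) x"
  unfolding has_partial_def
  by (auto simp: axis_def intro!: derivative_eq_intros)

lemma has_partial_cong:
  assumes "has_partial i f d x" "open S" "x \<in> S" "\<And>y. y \<in> S \<Longrightarrow> f y = g y"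
  shows "has_partial i g d x"
proof -
  have "open ((\<lambda>t::real. x + t *\<^sub>R axis i 1) -` S)"
    by (intro open_vimage assms continuous_intros)
  then have "eventually (\<lambda>t. t \<in> (\<lambda>t::real. x + t *\<^sub>R axis i 1) -` S) (nhds 0)"
    by (rule eventually_nhds_in_open) (use assms in simp)
  then have "eventually (\<lambda>t. f (x + t *\<^sub>R axis i 1) = g (x + t *\<^sub>R axis i 1)) (nhds 0)"
    by (rule eventually_mono) (use assms in auto)
  then show ?thesis
    using assms(1) by (simp add: has_partial_def DERIV_cong_ev[OF refl _ refl])
qed

lemma has_partial_zero_off_closed:
  assumes "closed K" "x \<notin> K" "\<And>y. y \<notin> K \<Longrightarrow> f y = 0"
  shows "has_partial i f 0 x"
  by (rule has_partial_cong[OF has_partial_const[of i 0], of "- K"]) (use assms in auto)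

lemma C1_on_I:
  assumes "continuous_on G f"
    and "\<And>i x. x \<in> G \<Longrightarrow> has_partial i f (f' i x) x"
    and "\<And>i. continuous_on G (f' i)"
  shows "C1_on G f"
proof -
  have "partial_deriv i f x = f' i x" if "x \<in> G" for i x
    using assms(2)[OF that] by (rule partial_deriv_eqI)
  then show ?thesis
    using assms continuous_on_cong[of G G "partial_deriv i f" "f' i" for i]
    by (auto simp: C1_on_def partial_differentiable_iff_has_partial)
qed

lemma C1_on_has_partial: "C1_on G f \<Longrightarrow> x \<in> G \<Longrightarrow> has_partial i f (partial_deriv i f x) x"
  by (simp add: C1_on_def partial_differentiable_iff_has_partial)

lemma C1_on_imp_continuous_on: "C1_on G f \<Longrightarrow> continuous_on G f"
  by (simp add: C1_on_def)

lemma C1_on_imp_continuous_on_partial: "C1_on G f \<Longrightarrow> continuous_on G (partial_deriv i f)"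
  by (simp add: C1_on_def)

lemma C2_on_imp_C1_on: "C2_on G f \<Longrightarrow> C1_on G f"
  by (simp add: C2_on_def)

lemma C2_on_imp_C1_on_partial: "C2_on G f \<Longrightarrow> C1_on G (partial_deriv i f)"
  by (simp add: C2_on_def)

lemma C1_on_subset: "C1_on G f \<Longrightarrow> H \<subseteq> G \<Longrightarrow> C1_on H f"
  by (auto simp: C1_on_def intro: continuous_on_subset)

lemma C2_on_subset: "C2_on G f \<Longrightarrow> H \<subseteq> G \<Longrightarrow> C2_on H f"
  by (auto simp: C2_on_def intro: C1_on_subset)

lemma C1_on_cong:
  assumes "C1_on G f" "open G" "\<And>x. x \<in> G \<Longrightarrow> f x = g x"
  shows "C1_on G g"
proof (rule C1_on_I)
  show "continuous_on G g"
    using continuous_on_cong[of G G f g] C1_on_imp_continuous_on[OF assms(1)] assms(3) by simp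
  show "has_partial i g (partial_deriv i f x) x" if "x \<in> G" for i x
    using has_partial_cong[OF C1_on_has_partial] assms that by blast
qed (use assms in \<open>simp add: C1_on_def\<close>)

lemma C1_on_const: "C1_on G (\<lambda>x. c)"
  by (rule C1_on_I[where f' = "\<lambda>i x. 0"]) (auto intro: has_partial_const)

lemma C1_on_coordinate: "C1_on G (\<lambda>x. (x - p) $ k)"
  by (rule C1_on_I[where f' = "\<lambda>i x. if k = i then 1 else 0"])
    (rule continuous_intros has_partial_coordinate)+

lemma C1_on_add: "C1_on G f \<Longrightarrow> C1_on G g \<Longrightarrow> C1_on G (\<lambda>x. f x + g x)"
  by (rule C1_on_I[where f' = "\<lambda>i x. partial_deriv i f x + partial_deriv i g x"])
    (auto intro!: has_partial_add continuous_intros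
      intro: C1_on_has_partial C1_on_imp_continuous_on C1_on_imp_continuous_on_partial)

lemma C1_on_mult: "C1_on G f \<Longrightarrow> C1_on G g \<Longrightarrow> C1_on G (\<lambda>x. f x * g x)"
  by (rule C1_on_I[where f' = "\<lambda>i x. partial_deriv i f x * g x + partial_deriv i g x * f x"])
    (auto intro!: has_partial_mult continuous_intros
      intro: C1_on_has_partial C1_on_imp_continuous_on C1_on_imp_continuous_on_partial)

lemma C1_on_diff: "C1_on G f \<Longrightarrow> C1_on G g \<Longrightarrow> C1_on G (\<lambda>x. f x - g x)"
  using C1_on_add[of G f "\<lambda>x. (- 1) * g x"] C1_on_mult[OF C1_on_const[of G "- 1"], of g] by simp

lemma C1_on_sum:
  assumes "finite A" "\<And>k. k \<in> A \<Longrightarrow> C1_on G (f k)"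
  shows "C1_on G (\<lambda>x. \<Sum>k\<in>A. f k x)"
  using assms by (induction A rule: finite_induct) (auto intro: C1_on_const C1_on_add)

lemma has_partial_sum:
  assumes "finite A" "\<And>k. k \<in> A \<Longrightarrow> has_partial i (f k) (d k) x"
  shows "has_partial i (\<lambda>x. \<Sum>k\<in>A. f k x) (\<Sum>k\<in>A. d k) x"
  using assms by (induction A rule: finite_induct) (auto intro: has_partial_const has_partial_add)

text \<open>Second difference quotients of \<open>f\<close> in the directions \<open>i\<close> and \<open>j\<close> do not depend on the
  order of the two directions; two applications of the mean value theorem turn them into a mixed
  second derivative at a nearby point.\<close>

lemma second_difference_mean_value:
  assumes "0 < h" and C2: "C2_on (ball x r) f" and h: "2 * h < r"
  obtains \<xi> where "dist x \<xi> \<le> 2 * h"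
    "f (x + h *\<^sub>R axis i 1 + h *\<^sub>R axis j 1) - f (x + h *\<^sub>R axis i 1)
      - f (x + h *\<^sub>R axis j 1) + f x = h * h * partial_deriv j (partial_deriv i f) \<xi>"
proof -
  have near: "dist x (x + s *\<^sub>R axis i 1 + t *\<^sub>R axis j 1) \<le> 2 * h"
    if "0 \<le> s" "s \<le> h" "0 \<le> t" "t \<le> h" for s t
  proof -
    have "dist x (x + s *\<^sub>R axis i 1 + t *\<^sub>R axis j 1)
        = norm (s *\<^sub>R axis i (1::real) + t *\<^sub>R axis j 1)"
      by (metis add.assoc add_diff_cancel_left' dist_commute dist_norm)
    also have "\<dots> \<le> s + t"
      using that norm_triangle_ineq[of "s *\<^sub>R axis i (1::real)" "t *\<^sub>R axis j 1"] by simp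
    finally show ?thesis using that by simp
  qed
  have near1: "dist x (x + s *\<^sub>R axis i 1) \<le> 2 * h" if "0 \<le> s" "s \<le> h" for s
    using near[OF that, of 0] \<open>0 < h\<close> by simp
  define F where "F s = f (x + h *\<^sub>R axis j 1 + s *\<^sub>R axis i 1) - f (x + s *\<^sub>R axis i 1)" for s
  have F: "(F has_real_derivative partial_deriv i f (x + h *\<^sub>R axis j 1 + s *\<^sub>R axis i 1)
      - partial_deriv i f (x + s *\<^sub>R axis i 1)) (at s)" if "0 \<le> s" "s \<le> h" for s
    unfolding F_def
    by (intro DERIV_diff has_partial_along_line C1_on_has_partial[OF C2_on_imp_C1_on[OF C2]])
      (use near[OF that, of h] near1[OF that] h \<open>0 < h\<close> in \<open>auto simp: add.commute add.left_commute\<close>)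
  obtain s where s: "0 < s" "s < h" and Fs: "F h - F 0 = (h - 0) *
      (partial_deriv i f (x + h *\<^sub>R axis j 1 + s *\<^sub>R axis i 1)
      - partial_deriv i f (x + s *\<^sub>R axis i 1))"
    using MVT2[OF \<open>0 < h\<close> F] by blast
  define H where "H t = partial_deriv i f (x + s *\<^sub>R axis i 1 + t *\<^sub>R axis j 1)" for t
  have H: "(H has_real_derivative
      partial_deriv j (partial_deriv i f) (x + s *\<^sub>R axis i 1 + t *\<^sub>R axis j 1)) (at t)"
    if "0 \<le> t" "t \<le> h" for t
    unfolding H_def
    by (intro has_partial_along_line C1_on_has_partial[OF C2_on_imp_C1_on_partial[OF C2]])
      (use near[OF _ _ that, of s] s h in auto)
  obtain t where t: "0 < t" "t < h" and Ht: "H h - H 0 = (h - 0) *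
      partial_deriv j (partial_deriv i f) (x + s *\<^sub>R axis i 1 + t *\<^sub>R axis j 1)"
    using MVT2[OF \<open>0 < h\<close> H] by blast
  show ?thesis
  proof
    show "dist x (x + s *\<^sub>R axis i 1 + t *\<^sub>R axis j 1) \<le> 2 * h"
      using near s t by simp
    have "F h - F 0 = h * (H h - H 0)"
      using Fs by (simp add: H_def add.commute add.left_commute)
    then show "f (x + h *\<^sub>R axis i 1 + h *\<^sub>R axis j 1) - f (x + h *\<^sub>R axis i 1)
      - f (x + h *\<^sub>R axis j 1) + f x
      = h * h * partial_deriv j (partial_deriv i f) (x + s *\<^sub>R axis i 1 + t *\<^sub>R axis j 1)"
      unfolding Ht by (simp add: F_def add.commute add.left_commute)
  qed
qed

text \<open>Both mixed derivatives are limits of the same second difference quotient.\<close>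

lemma mixed_partials_commute:
  assumes "open G" "x \<in> G" "C2_on G f"
  shows "partial_deriv j (partial_deriv i f) x = partial_deriv i (partial_deriv j f) x"
proof (rule ccontr)
  define P where "P = partial_deriv j (partial_deriv i f)"
  define Q where "Q = partial_deriv i (partial_deriv j f)"
  assume "\<not> ?thesis"
  then have "0 < \<bar>P x - Q x\<bar> / 2" (is "0 < ?e")
    by (simp add: P_def Q_def)
  obtain r where r: "0 < r" "ball x r \<subseteq> G"
    using assms open_contains_ball by blast
  note C2 = C2_on_subset[OF assms(3) r(2)]
  have cont: "continuous (at x) P" "continuous (at x) Q"
    using assms C1_on_imp_continuous_on_partial[OF C2_on_imp_C1_on_partial[OF assms(3)]]
    by (auto simp: P_def Q_def continuous_on_eq_continuous_at)
  obtain d1 where d1: "0 < d1" "\<And>y. dist y x < d1 \<Longrightarrow> dist (P y) (P x) < ?e"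
    using cont(1) \<open>0 < ?e\<close> unfolding continuous_at_eps_delta by blast
  obtain d2 where d2: "0 < d2" "\<And>y. dist y x < d2 \<Longrightarrow> dist (Q y) (Q x) < ?e"
    using cont(2) \<open>0 < ?e\<close> unfolding continuous_at_eps_delta by blast
  define h where "h = min r (min d1 d2) / 3"
  have h: "0 < h" "2 * h < r" "2 * h < d1" "2 * h < d2"
    using r d1 d2 by (auto simp: h_def)
  obtain \<xi> where xi: "dist x \<xi> \<le> 2 * h"
    "f (x + h *\<^sub>R axis i 1 + h *\<^sub>R axis j 1) - f (x + h *\<^sub>R axis i 1)
      - f (x + h *\<^sub>R axis j 1) + f x = h * h * P \<xi>"
    using second_difference_mean_value[OF h(1) C2 h(2)] unfolding P_def by metis
  obtain \<eta> where eta: "dist x \<eta> \<le> 2 * h"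
    "f (x + h *\<^sub>R axis j 1 + h *\<^sub>R axis i 1) - f (x + h *\<^sub>R axis j 1)
      - f (x + h *\<^sub>R axis i 1) + f x = h * h * Q \<eta>"
    using second_difference_mean_value[OF h(1) C2 h(2)] unfolding Q_def by metis
  have "h * h * P \<xi> = h * h * Q \<eta>"
    using xi(2) eta(2) by (simp add: algebra_simps)
  then have "P \<xi> = Q \<eta>"
    using h by simp
  moreover have "dist (P \<xi>) (P x) < ?e" "dist (Q \<eta>) (Q x) < ?e"
    using d1(2)[of \<xi>] d2(2)[of \<eta>] xi(1) eta(1) h by (auto simp: dist_commute)
  ultimately have "dist (P x) (Q x) < \<bar>P x - Q x\<bar>"
    by (metis dist_commute dist_triangle_half_l)
  then show False
    by (simp add: dist_real_def)
qed

section \<open>Divergences of compactly supported fields\<close>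

text \<open>The integral of the difference quotient of \<open>F\<close> in direction \<open>i\<close> vanishes because Lebesgue
  measure is invariant under translations; the difference quotients converge to the derivative
  with a common compactly supported bound. Extended by zero off \<open>K\<close>, both \<open>F\<close> and its derivative are
  continuous on the whole space.\<close>

lemma integral_partial_deriv_eq_0:
  fixes F :: "real^'n \<Rightarrow> real"
  assumes "open U" "compact K" "K \<subseteq> U" and C1: "C1_on U F" and F0: "\<And>x. x \<notin> K \<Longrightarrow> F x = 0"
  shows "integrable lborel (partial_deriv i F)" "integral\<^sup>L lborel (partial_deriv i F) = 0"
proof -
  let ?e = "axis i 1 :: real^'n"
  define F' where "F' = partial_deriv i F"
  have off: "has_partial i F 0 x" if "x \<notin> K" for x
    by (rule has_partial_zero_off_closed[OF compact_imp_closed[OF assms(2)] that F0])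
  then have F'0: "F' x = 0" if "x \<notin> K" for x
    using that by (simp add: F'_def partial_deriv_eqI)
  have der: "has_partial i F (F' x) x" for x
    using off F'0 C1_on_has_partial[OF C1] assms(3) unfolding F'_def by (metis subsetD)
  have ext: "continuous_on UNIV g" if "continuous_on U g" "\<And>x. x \<notin> K \<Longrightarrow> g x = 0" 
    for g :: "real^'n \<Rightarrow> real"
  proof -
    have "continuous_on (- K) g"
      using that(2) continuous_on_cong[of "- K" "- K" g "\<lambda>x. 0"] by auto
    then have "continuous_on (U \<union> - K) g"
      by (intro continuous_on_open_Un that assms) (use assms in \<open>auto intro: compact_imp_closed\<close>)
    moreover have "U \<union> - K = UNIV" using assms(3) by blast
    ultimately show ?thesis by simp
  qed
  have contF: "continuous_on UNIV F"
    using ext C1_on_imp_continuous_on[OF C1] F0 by blast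
  have contF': "continuous_on UNIV F'"
    using ext C1_on_imp_continuous_on_partial[OF C1] F'0 unfolding F'_def by blast
  obtain B where B: "\<And>x. x \<in> K \<Longrightarrow> norm x \<le> B"
    using compact_imp_bounded[OF assms(2)] bounded_iff by blast
  have "compact (F' ` K)"
    using compact_continuous_image[OF continuous_on_subset[OF contF'] assms(2)] by simp
  then obtain M0 where M0: "\<And>x. x \<in> K \<Longrightarrow> \<bar>F' x\<bar> \<le> M0"
    using compact_imp_bounded bounded_iff by (metis imageI real_norm_def)
  define M where "M = max M0 0"
  have M: "\<bar>F' x\<bar> \<le> M" for x
    using M0[of x] F'0[of x] by (cases "x \<in> K") (auto simp: M_def)
  have integF: "integrable lborel F"
    using borel_integrable_compact[OF assms(2) continuous_on_subset[OF contF]]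
    by (rule Bochner_Integration.integrable_cong[THEN iffD1, rotated -1])
      (auto simp: F0 indicator_def)
  have [measurable]: "F \<in> borel_measurable borel" "F' \<in> borel_measurable borel"
    using contF contF' by (auto intro: borel_measurable_continuous_onI)
  have shift: "integrable lborel (\<lambda>x. F (x + c))"
    "integral\<^sup>L lborel (\<lambda>x. F (x + c)) = integral\<^sup>L lborel F" for c
  proof -
    have "integrable (distr lborel borel (\<lambda>x. c + x)) F"
      using integF by (simp add: lborel_distr_plus)
    then show "integrable lborel (\<lambda>x. F (x + c))"
      by (subst (asm) integrable_distr_eq) (auto simp: add.commute)
    have "integral\<^sup>L lborel F = integral\<^sup>L (distr lborel borel (\<lambda>x. c + x)) F"
      by (simp add: lborel_distr_plus)
    also have "\<dots> = integral\<^sup>L lborel (\<lambda>x. F (x + c))"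
      by (subst integral_distr) (auto simp: add.commute)
    finally show "integral\<^sup>L lborel (\<lambda>x. F (x + c)) = integral\<^sup>L lborel F" by simp
  qed
  \<comment> \<open>The difference quotients with step \<open>1 / Suc n\<close>; the mean value theorem bounds them by the
    maximum \<open>M\<close> of \<open>\<bar>F'\<bar>\<close>, and a step of length at most one keeps their support in a larger ball.\<close>
  define q where "q n x = (F (x + (1 / Suc n) *\<^sub>R ?e) - F x) / (1 / Suc n)" for n :: nat and x
  have q_integral: "integral\<^sup>L lborel (q n) = 0" for n
    unfolding q_def using shift integF by (simp del: of_nat_Suc)
  have q_bound: "norm (q n x) \<le> M * indicator (cball 0 (B + 1)) x" for n x
  proof (cases "norm x \<le> B + 1")
    case True
    have h: "(0::real) < 1 / Suc n" by simp
    obtain s where s: "F (x + (1 / Suc n) *\<^sub>R ?e) - F (x + 0 *\<^sub>R ?e)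
        = (1 / Suc n - 0) * F' (x + s *\<^sub>R ?e)"
      using MVT2[OF h, of "\<lambda>t. F (x + t *\<^sub>R ?e)" "\<lambda>t. F' (x + t *\<^sub>R ?e)"]
        has_partial_along_line[OF der] by blast
    then have "q n x = F' (x + s *\<^sub>R ?e)"
      by (simp add: q_def)
    then show ?thesis using M True by simp
  next
    case False
    define y where "y = (1 / Suc n) *\<^sub>R ?e"
    have "norm y \<le> 1"
      by (simp add: y_def)
    moreover have "norm x \<le> norm (x + y) + norm y"
      using norm_triangle_ineq4[of "x + y" y] by simp
    ultimately have "norm (x + (1 / Suc n) *\<^sub>R ?e) > B"
      using False unfolding y_def by linarith
    then have "x + (1 / Suc n) *\<^sub>R ?e \<notin> K" "x \<notin> K"
      using B False by fastforce+
    then show ?thesis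
      using F0 False by (simp add: q_def)
  qed
  have q_lim: "(\<lambda>n. q n x) \<longlonglongrightarrow> F' x" for x
  proof -
    have "((\<lambda>h. (F (x + h *\<^sub>R ?e) - F x) / h) \<longlongrightarrow> F' x) (at 0)"
      using der[of x] by (simp add: has_partial_def DERIV_def)
    moreover have "filterlim (\<lambda>n. 1 / Suc n) (at (0::real)) sequentially"
      unfolding filterlim_at using LIMSEQ_inverse_real_of_nat
      by (auto simp: inverse_eq_divide simp del: of_nat_Suc)
    ultimately show ?thesis
      unfolding q_def by (rule filterlim_compose)
  qed
  have dom: "integrable lborel (\<lambda>x. M * indicator (cball 0 (B + 1)) x :: real)"
    by (intro integrable_mult_right integrable_real_indicator)
      (use emeasure_lborel_cball_finite in auto)
  have [measurable]: "q n \<in> borel_measurable lborel" for n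
    unfolding q_def by measurable
  show "integrable lborel (partial_deriv i F)"
    unfolding F'_def[symmetric]
    by (rule integrable_dominated_convergence[OF _ _ dom AE_I2[OF q_lim] AE_I2[OF q_bound]]) auto
  have "(\<lambda>n. integral\<^sup>L lborel (q n)) \<longlonglongrightarrow> integral\<^sup>L lborel F'"
    by (rule integral_dominated_convergence[OF _ _ dom AE_I2[OF q_lim] AE_I2[OF q_bound]]) auto
  then show "integral\<^sup>L lborel (partial_deriv i F) = 0"
    by (simp add: q_integral F'_def LIMSEQ_const_iff)
qed

section \<open>Radial functions\<close>

definition sqdist :: "real^'n \<Rightarrow> real^'n \<Rightarrow> real"
  where "sqdist p x = (x - p) \<bullet> (x - p)"

lemma sqdist_pos_iff: "0 < sqdist p x \<longleftrightarrow> x \<noteq> p"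
  by (simp add: sqdist_def)

lemma norm_diff_power2_eq_sqdist: "(norm (x - p))^2 = sqdist p x"
  by (simp add: sqdist_def power2_norm_eq_inner)

lemma has_partial_sqdist: "has_partial i (sqdist p) (2 * (x - p) $ i) x"
proof -
  have "has_partial i (\<lambda>x. \<Sum>k\<in>UNIV. (x - p) $ k * (x - p) $ k)
    (\<Sum>k\<in>UNIV. (if k = i then 1 else 0) * (x - p) $ k + (if k = i then 1 else 0) * (x - p) $ k) x"
    by (intro has_partial_sum has_partial_mult has_partial_coordinate finite_class.finite_UNIV)
  moreover have "(\<lambda>x. \<Sum>k\<in>UNIV. (x - p) $ k * (x - p) $ k) = sqdist p"
    by (simp add: fun_eq_iff sqdist_def inner_vec_def)
  moreover have "(\<Sum>k\<in>UNIV. (if k = i then 1 else 0) * (x - p) $ k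
      + (if k = i then 1 else 0) * (x - p) $ k) = 2 * (x - p) $ i"
  proof -
    have "(\<Sum>k\<in>UNIV. (if k = i then 1 else 0) * (x - p) $ k + (if k = i then 1 else 0) * (x - p) $ k)
      = (\<Sum>k\<in>UNIV. if k = i then 2 * (x - p) $ k else 0)"
      by (intro sum.cong) auto
    then show ?thesis by simp
  qed
  ultimately show ?thesis by simp
qed

lemma continuous_on_sqdist: "continuous_on G (sqdist p)"
  unfolding sqdist_def by (intro continuous_intros)

lemma has_partial_radial:
  assumes "(a has_real_derivative a') (at (sqdist p x))"
  shows "has_partial i (\<lambda>x. a (sqdist p x)) (a' * (2 * (x - p) $ i)) x"
  using has_partial_compose[OF assms has_partial_sqdist] .

lemma C1_on_radial:
  assumes "\<And>x. x \<in> G \<Longrightarrow> (a has_real_derivative a' (sqdist p x)) (at (sqdist p x))"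
    and "continuous_on (sqdist p ` G) a'"
  shows "C1_on G (\<lambda>x. a (sqdist p x))"
proof (rule C1_on_I)
  have "continuous_on (sqdist p ` G) a"
    using assms(1) by (auto intro!: continuous_at_imp_continuous_on DERIV_isCont)
  then show "continuous_on G (\<lambda>x. a (sqdist p x))"
    by (rule continuous_on_compose2[OF _ continuous_on_sqdist]) auto
  show "has_partial i (\<lambda>x. a (sqdist p x)) (a' (sqdist p x) * (2 * (x - p) $ i)) x"
    if "x \<in> G" for i x
    by (rule has_partial_radial[OF assms(1)[OF that]])
  show "continuous_on G (\<lambda>x. a' (sqdist p x) * (2 * (x - p) $ i))" for i
    by (intro continuous_intros continuous_on_compose2[OF assms(2) continuous_on_sqdist]) auto
qed

context
  fixes G :: "(real^'n) set" and p :: "real^'n" and u :: "real^'n \<Rightarrow> real"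
    and h h' h'' :: "real \<Rightarrow> real"
  assumes G: "open G" and u: "C2_on G u"
    and h: "\<And>x. x \<in> G \<Longrightarrow> (h has_real_derivative h' (sqdist p x)) (at (sqdist p x))"
    and h': "\<And>x. x \<in> G \<Longrightarrow> (h' has_real_derivative h'' (sqdist p x)) (at (sqdist p x))"
    and h'': "continuous_on (sqdist p ` G) h''"
begin

text \<open>These rules for products with a radial factor are used twice: for the weight and for the cutoff.\<close>

lemma has_partial_radial_mult:
  assumes "x \<in> G"
  shows "has_partial i (\<lambda>x. h (sqdist p x) * u x)
    (h (sqdist p x) * partial_deriv i u x + 2 * h' (sqdist p x) * (x - p) $ i * u x) x"
  by (rule has_partial_eq_rhs[OF has_partial_mult[OF has_partial_radial[OF h[OF assms]]
      C1_on_has_partial[OF C2_on_imp_C1_on[OF u] assms]]]) simp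

lemma gradient_radial_mult:
  assumes "x \<in> G"
  shows "gradient (\<lambda>x. h (sqdist p x) * u x) x
    = h (sqdist p x) *\<^sub>R gradient u x + (2 * h' (sqdist p x) * u x) *\<^sub>R (x - p)"
  using partial_deriv_eqI[OF has_partial_radial_mult[OF assms]]
  by (simp add: vec_eq_iff gradient_def)

lemma C1_on_radial_factors:
  "C1_on G (\<lambda>x. h (sqdist p x))" "C1_on G (\<lambda>x. h' (sqdist p x))"
proof -
  have "continuous_on (sqdist p ` G) h'"
    using h' by (auto intro!: continuous_at_imp_continuous_on DERIV_isCont)
  then show "C1_on G (\<lambda>x. h (sqdist p x))" "C1_on G (\<lambda>x. h' (sqdist p x))"
    using C1_on_radial h h' h'' by blast+
qed

lemma C2_on_radial_mult: "C2_on G (\<lambda>x. h (sqdist p x) * u x)"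
  unfolding C2_on_def
proof (intro conjI allI)
  show "C1_on G (\<lambda>x. h (sqdist p x) * u x)"
    by (intro C1_on_mult C1_on_radial_factors C2_on_imp_C1_on u)
  have "C1_on G (\<lambda>x. h (sqdist p x) * partial_deriv i u x
      + 2 * h' (sqdist p x) * (x - p) $ i * u x)" for i
    by (intro C1_on_add C1_on_mult C1_on_radial_factors C2_on_imp_C1_on C2_on_imp_C1_on_partial u
        C1_on_const C1_on_coordinate)
  then show "C1_on G (partial_deriv i (\<lambda>x. h (sqdist p x) * u x))" for i
    by (rule C1_on_cong[OF _ G]) (simp add: partial_deriv_eqI[OF has_partial_radial_mult])
qed

lemma laplacian_radial_mult:
  assumes "x \<in> G"
  shows "laplacian (\<lambda>x. h (sqdist p x) * u x) x
    = h (sqdist p x) * laplacian u x + 4 * h' (sqdist p x) * ((x - p) \<bullet> gradient u x)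
      + (4 * sqdist p x * h'' (sqdist p x) + 2 * CARD('n) * h' (sqdist p x)) * u x"
proof -
  define r where "r = sqdist p x"
  have pd: "has_partial i (partial_deriv i (\<lambda>x. h (sqdist p x) * u x))
      (h r * partial_deriv i (partial_deriv i u) x + 4 * h' r * ((x - p) $ i * partial_deriv i u x)
        + (4 * h'' r * ((x - p) $ i * (x - p) $ i) + 2 * h' r) * u x) x" for i
  proof (rule has_partial_cong[OF _ G assms])
    show "has_partial i (\<lambda>x. h (sqdist p x) * partial_deriv i u x
        + 2 * h' (sqdist p x) * (x - p) $ i * u x)
      (h r * partial_deriv i (partial_deriv i u) x + 4 * h' r * ((x - p) $ i * partial_deriv i u x)
        + (4 * h'' r * ((x - p) $ i * (x - p) $ i) + 2 * h' r) * u x) x"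
      by (rule has_partial_eq_rhs[OF has_partial_add[OF
        has_partial_mult[OF has_partial_radial[OF h[OF assms]]
          C1_on_has_partial[OF C2_on_imp_C1_on_partial[OF u] assms]]
        has_partial_mult[OF has_partial_mult[OF has_partial_mult[OF has_partial_const
            has_partial_radial[OF h'[OF assms]]] has_partial_coordinate]
          C1_on_has_partial[OF C2_on_imp_C1_on[OF u] assms]]]])
        (simp add: r_def algebra_simps)
  qed (simp add: partial_deriv_eqI[OF has_partial_radial_mult])
  have r_eq: "(\<Sum>i\<in>UNIV. (x - p) $ i * (x - p) $ i) = r"
    by (simp add: r_def sqdist_def inner_vec_def)
  have grad: "(x - p) \<bullet> gradient u x = (\<Sum>i\<in>UNIV. (x - p) $ i * partial_deriv i u x)"
    by (simp add: inner_vec_def gradient_def)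
  show ?thesis
    unfolding laplacian_def partial_deriv_eqI[OF pd] r_def[symmetric] grad
    by (simp add: sum.distrib distrib_right r_eq flip: sum_distrib_left sum_distrib_right
        del: vector_minus_component)
qed

end

section \<open>Radial multiplier identities\<close>

definition divergence :: "('n \<Rightarrow> real^'n \<Rightarrow> real) \<Rightarrow> real^'n \<Rightarrow> real"
  where "divergence V x = (\<Sum>j\<in>UNIV. partial_deriv j (V j) x)"

lemma divergence_eqI: "(\<And>j. has_partial j (V j) (d j) x) \<Longrightarrow> divergence V x = (\<Sum>j\<in>UNIV. d j)"
  unfolding divergence_def by (intro sum.cong refl partial_deriv_eqI)

lemma integral_divergence_eq_0:
  fixes V :: "'n \<Rightarrow> real^'n \<Rightarrow> real"
  assumes "open U" "compact K" "K \<subseteq> U" "\<And>j. C1_on U (V j)" "\<And>j x. x \<notin> K \<Longrightarrow> V j x = 0"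
  shows "set_integrable lborel K (divergence V)" "(LINT x:K|lborel. divergence V x) = 0"
proof -
  note pd = integral_partial_deriv_eq_0[OF assms(1-3) assms(4,5)]
  have "partial_deriv j (V j) x = 0" if "x \<notin> K" for j x
    using has_partial_zero_off_closed[OF compact_imp_closed[OF assms(2)] that assms(5)]
    by (rule partial_deriv_eqI)
  then have eq: "(\<lambda>x. indicator K x *\<^sub>R divergence V x) = divergence V"
    by (auto simp: fun_eq_iff indicator_def divergence_def)
  show "set_integrable lborel K (divergence V)" "(LINT x:K|lborel. divergence V x) = 0"
    unfolding set_integrable_def set_lebesgue_integral_def eq
    unfolding divergence_def[abs_def] using pd by simp_all
qed

lemma C1_on_inner_gradient:
  assumes "C2_on G w"
  shows "C1_on G (\<lambda>x. (x - p) \<bullet> gradient w x)" "C1_on G (\<lambda>x. gradient w x \<bullet> gradient w x)"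
  unfolding inner_vec_def gradient_def inner_real_def vec_lambda_beta
  by (intro C1_on_sum C1_on_mult C1_on_coordinate C2_on_imp_C1_on_partial assms finite)+

lemma has_partial_inner_gradient:
  assumes "C2_on G w" "x \<in> G"
  shows "has_partial j (\<lambda>x. (x - p) \<bullet> gradient w x)
      (partial_deriv j w x + (\<Sum>k\<in>UNIV. (x - p) $ k * partial_deriv j (partial_deriv k w) x)) x"
    and "has_partial j (\<lambda>x. gradient w x \<bullet> gradient w x)
      (2 * (\<Sum>k\<in>UNIV. partial_deriv k w x * partial_deriv j (partial_deriv k w) x)) x"
proof -
  note pd = C1_on_has_partial[OF C2_on_imp_C1_on_partial[OF assms(1)] assms(2)]
  have "has_partial j (\<lambda>x. \<Sum>k\<in>UNIV. (x - p) $ k * partial_deriv k w x)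
    (\<Sum>k\<in>UNIV. (if k = j then 1 else 0) * partial_deriv k w x
      + partial_deriv j (partial_deriv k w) x * (x - p) $ k) x"
    by (intro has_partial_sum has_partial_mult has_partial_coordinate pd finite)
  then show "has_partial j (\<lambda>x. (x - p) \<bullet> gradient w x)
      (partial_deriv j w x + (\<Sum>k\<in>UNIV. (x - p) $ k * partial_deriv j (partial_deriv k w) x)) x"
    by (simp add: inner_vec_def gradient_def sum.distrib mult.commute
        if_distrib[of "\<lambda>a. b * a" for b] cong: if_cong)
  have "has_partial j (\<lambda>x. \<Sum>k\<in>UNIV. partial_deriv k w x * partial_deriv k w x)
    (\<Sum>k\<in>UNIV. partial_deriv j (partial_deriv k w) x * partial_deriv k w x
      + partial_deriv j (partial_deriv k w) x * partial_deriv k w x) x"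
    by (intro has_partial_sum has_partial_mult pd finite)
  then show "has_partial j (\<lambda>x. gradient w x \<bullet> gradient w x)
      (2 * (\<Sum>k\<in>UNIV. partial_deriv k w x * partial_deriv j (partial_deriv k w) x)) x"
    by (simp add: inner_vec_def gradient_def sum_distrib_left mult.commute)
qed

context
  fixes G :: "(real^'n) set" and p :: "real^'n" and w :: "real^'n \<Rightarrow> real"
    and a a' :: "real \<Rightarrow> real"
  assumes G: "open G" and w: "C2_on G w"
    and a: "\<forall>x\<in>G. (a has_real_derivative a' (sqdist p x)) (at (sqdist p x))"
    and a': "continuous_on (sqdist p ` G) a'"
begin

text \<open>The next three lemmas are the Rellich--Pohozaev identities with a radial coefficient \<open>a\<close>: after
  integration they express the products of \<open>\<Delta> w\<close> with the multipliers \<open>a E w\<close> and \<open>a w\<close>, and of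
  \<open>w\<close> with \<open>a E w\<close>, as quadratic forms in \<open>w\<close> and its first derivatives.

  In the first one, \<open>E w\<close> differentiated along \<open>\<nabla> w\<close> and \<open>\<bar>\<nabla> w\<bar>\<^sup>2 / 2\<close> differentiated along
  \<open>x - p\<close> produce the same term in the Hessian of \<open>w\<close>, by symmetry of the Hessian; the two cancel,
  and only \<open>\<Delta> w\<close> remains of the second derivatives.\<close>

lemma divergence_euler_gradient:
  defines "V \<equiv> \<lambda>j x. a (sqdist p x) * (((x - p) \<bullet> gradient w x) * partial_deriv j w x
      - (x - p) $ j * ((1/2) * (gradient w x \<bullet> gradient w x)))"
  shows "C1_on G (V j)"
    and "x \<in> G \<Longrightarrow> divergence V x
      = a (sqdist p x) * (((x - p) \<bullet> gradient w x) * laplacian w x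
          + (1 - CARD('n) / 2) * (gradient w x \<bullet> gradient w x))
        + a' (sqdist p x) * (2 * ((x - p) \<bullet> gradient w x)^2
          - sqdist p x * (gradient w x \<bullet> gradient w x))"
proof -
  show "C1_on G (V j)"
    unfolding V_def
    by (intro C1_on_mult C1_on_diff C1_on_radial[OF bspec[OF a] a'] C1_on_inner_gradient C1_on_const
        C1_on_coordinate C2_on_imp_C1_on_partial w)
  assume x: "x \<in> G"
  define E where "E = (x - p) \<bullet> gradient w x"
  define Q where "Q = gradient w x \<bullet> gradient w x"
  define r where "r = sqdist p x"
  define X where "X k = (x - p) $ k" for k
  define W where "W k = partial_deriv k w x" for k
  define H where "H j k = partial_deriv j (partial_deriv k w) x" for j k
  have sym: "H j k = H k j" for j k
    unfolding H_def by (rule mixed_partials_commute[OF G x w])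
  have E: "E = (\<Sum>k\<in>UNIV. X k * W k)" and Q: "Q = (\<Sum>k\<in>UNIV. W k * W k)"
    and r: "r = (\<Sum>k\<in>UNIV. X k * X k)"
    by (simp_all add: E_def Q_def r_def X_def W_def sqdist_def inner_vec_def gradient_def)
  have lap: "laplacian w x = (\<Sum>j\<in>UNIV. H j j)"
    by (simp add: laplacian_def H_def)
  define d where "d j = (a' r * (2 * X j)) * (E * W j - X j * ((1/2) * Q))
     + a r * ((W j + (\<Sum>k\<in>UNIV. X k * H j k)) * W j + H j j * E
       - (1/2) * Q - X j * (\<Sum>k\<in>UNIV. W k * H j k))" for j
  have "has_partial j (V j) (d j) x" for j
    unfolding V_def
    by (rule has_partial_eq_rhs[OF has_partial_mult[OF has_partial_radial[OF bspec[OF a x]]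
       has_partial_diff[OF has_partial_mult[OF has_partial_inner_gradient(1)[OF w x]
            C1_on_has_partial[OF C2_on_imp_C1_on_partial[OF w] x]]
         has_partial_mult[OF has_partial_coordinate
          has_partial_mult[OF has_partial_const has_partial_inner_gradient(2)[OF w x]]]]]])
      (simp add: d_def E_def Q_def r_def X_def W_def H_def algebra_simps)
  then have "divergence V x = (\<Sum>j\<in>UNIV. d j)"
    by (rule divergence_eqI)
  also have "\<dots> = (\<Sum>j\<in>UNIV. a' r * (2 * E * (X j * W j)) - a' r * Q * (X j * X j)
      + a r * (W j * W j) + a r * E * H j j - a r * ((1/2) * Q)
      + a r * (\<Sum>k\<in>UNIV. X k * H j k * W j) - a r * (\<Sum>k\<in>UNIV. X j * H j k * W k))"
    unfolding d_def by (simp add: algebra_simps sum_distrib_left sum_distrib_right)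
  also have "\<dots> = a' r * (2 * E * E) - a' r * Q * r + a r * Q + a r * E * (\<Sum>j\<in>UNIV. H j j)
      - CARD('n) * (a r * ((1/2) * Q))
      + a r * (\<Sum>j\<in>UNIV. \<Sum>k\<in>UNIV. X k * H j k * W j)
      - a r * (\<Sum>j\<in>UNIV. \<Sum>k\<in>UNIV. X j * H j k * W k)"
    by (simp add: sum.distrib sum_subtractf flip: sum_distrib_left E Q r)
  also have "(\<Sum>j\<in>UNIV. \<Sum>k\<in>UNIV. X k * H j k * W j) = (\<Sum>j\<in>UNIV. \<Sum>k\<in>UNIV. X j * H j k * W k)"
    by (subst sum.swap) (simp add: sym)
  finally show "divergence V x
      = a (sqdist p x) * (((x - p) \<bullet> gradient w x) * laplacian w x
          + (1 - CARD('n) / 2) * (gradient w x \<bullet> gradient w x))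
        + a' (sqdist p x) * (2 * ((x - p) \<bullet> gradient w x)^2
          - sqdist p x * (gradient w x \<bullet> gradient w x))"
    unfolding lap E_def[symmetric] Q_def[symmetric] r_def[symmetric]
    by (simp add: algebra_simps power2_eq_square)
qed

lemma divergence_function_gradient:
  defines "V \<equiv> \<lambda>j x. a (sqdist p x) * (w x * partial_deriv j w x)"
  shows "C1_on G (V j)"
    and "x \<in> G \<Longrightarrow> divergence V x
      = a (sqdist p x) * (w x * laplacian w x + gradient w x \<bullet> gradient w x)
        + 2 * a' (sqdist p x) * w x * ((x - p) \<bullet> gradient w x)"
proof -
  show "C1_on G (V j)"
    unfolding V_def
    by (intro C1_on_mult C1_on_radial[OF bspec[OF a] a'] C2_on_imp_C1_on C2_on_imp_C1_on_partial w)
  assume x: "x \<in> G"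
  have "has_partial j (V j) (2 * a' (sqdist p x) * w x * ((x - p) $ j * partial_deriv j w x)
      + a (sqdist p x) * (partial_deriv j w x * partial_deriv j w x)
      + a (sqdist p x) * w x * partial_deriv j (partial_deriv j w) x) x" for j
    unfolding V_def
    by (rule has_partial_eq_rhs[OF has_partial_mult[OF has_partial_radial[OF bspec[OF a x]]
       has_partial_mult[OF C1_on_has_partial[OF C2_on_imp_C1_on[OF w] x]
            C1_on_has_partial[OF C2_on_imp_C1_on_partial[OF w] x]]]])
      (simp add: algebra_simps)
  then have "divergence V x = (\<Sum>j\<in>UNIV. 2 * a' (sqdist p x) * w x * ((x - p) $ j * partial_deriv j w x)
      + a (sqdist p x) * (partial_deriv j w x * partial_deriv j w x)
      + a (sqdist p x) * w x * partial_deriv j (partial_deriv j w) x)"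
    by (rule divergence_eqI)
  also have "\<dots> = 2 * a' (sqdist p x) * w x * ((x - p) \<bullet> gradient w x)
      + a (sqdist p x) * (gradient w x \<bullet> gradient w x) + a (sqdist p x) * w x * laplacian w x"
    by (simp add: sum.distrib inner_vec_def gradient_def laplacian_def
        flip: sum_distrib_left del: vector_minus_component)
  finally show "divergence V x
      = a (sqdist p x) * (w x * laplacian w x + gradient w x \<bullet> gradient w x)
        + 2 * a' (sqdist p x) * w x * ((x - p) \<bullet> gradient w x)"
    by (simp add: algebra_simps)
qed

lemma divergence_position_square:
  defines "V \<equiv> \<lambda>j x. a (sqdist p x) * ((x - p) $ j * (w x * w x))"
  shows "C1_on G (V j)"
    and "x \<in> G \<Longrightarrow> divergence V x
      = (CARD('n) * a (sqdist p x) + 2 * sqdist p x * a' (sqdist p x)) * (w x)^2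
        + 2 * a (sqdist p x) * w x * ((x - p) \<bullet> gradient w x)"
proof -
  show "C1_on G (V j)"
    unfolding V_def
    by (intro C1_on_mult C1_on_radial[OF bspec[OF a] a'] C1_on_coordinate C2_on_imp_C1_on w)
  assume x: "x \<in> G"
  have "has_partial j (V j) (2 * a' (sqdist p x) * (w x)^2 * ((x - p) $ j * (x - p) $ j)
      + a (sqdist p x) * (w x)^2
      + 2 * a (sqdist p x) * w x * ((x - p) $ j * partial_deriv j w x)) x" for j
    unfolding V_def
    by (rule has_partial_eq_rhs[OF has_partial_mult[OF has_partial_radial[OF bspec[OF a x]]
       has_partial_mult[OF has_partial_coordinate 
        has_partial_mult[OF C1_on_has_partial[OF C2_on_imp_C1_on[OF w] x]
            C1_on_has_partial[OF C2_on_imp_C1_on[OF w] x]]]]])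
      (simp add: algebra_simps power2_eq_square)
  then have "divergence V x = (\<Sum>j\<in>UNIV. 2 * a' (sqdist p x) * (w x)^2 * ((x - p) $ j * (x - p) $ j)
      + a (sqdist p x) * (w x)^2
      + 2 * a (sqdist p x) * w x * ((x - p) $ j * partial_deriv j w x))"
    by (rule divergence_eqI)
  also have "\<dots> = 2 * a' (sqdist p x) * (w x)^2 * (\<Sum>j\<in>UNIV. (x - p) $ j * (x - p) $ j)
      + CARD('n) * (a (sqdist p x) * (w x)^2)
      + 2 * a (sqdist p x) * w x * (\<Sum>j\<in>UNIV. (x - p) $ j * partial_deriv j w x)"
    by (simp add: sum.distrib flip: sum_distrib_left del: vector_minus_component)
  also have "(\<Sum>j\<in>UNIV. (x - p) $ j * (x - p) $ j) = sqdist p x"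
    by (simp add: sqdist_def inner_vec_def)
  also have "(\<Sum>j\<in>UNIV. (x - p) $ j * partial_deriv j w x) = (x - p) \<bullet> gradient w x"
    by (simp add: inner_vec_def gradient_def)
  finally show "divergence V x
      = (CARD('n) * a (sqdist p x) + 2 * sqdist p x * a' (sqdist p x)) * (w x)^2
        + 2 * a (sqdist p x) * w x * ((x - p) \<bullet> gradient w x)"
    by (simp add: algebra_simps)
qed

end

section \<open>A Carleman estimate\<close>

lemma C2_on_imp_continuous_on_gradient_laplacian:
  assumes "C2_on U v"
  shows "continuous_on U (\<lambda>x. gradient v x \<bullet> gradient v x)" "continuous_on U (laplacian v)"
proof -
  show "continuous_on U (\<lambda>x. gradient v x \<bullet> gradient v x)"
    by (intro C1_on_imp_continuous_on C1_on_inner_gradient assms)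
  show "continuous_on U (laplacian v)"
    unfolding laplacian_def[abs_def]
    by (intro continuous_on_sum C1_on_imp_continuous_on_partial C2_on_imp_C1_on_partial assms)
qed

lemma inverse_power_sqdist_derivative:
  assumes "p \<notin> U"
  shows "\<forall>x\<in>U. ((\<lambda>r. 1 / r ^ Suc k) has_real_derivative - real (Suc k) / sqdist p x ^ (k + 2))
      (at (sqdist p x))"
    and "continuous_on (sqdist p ` U) (\<lambda>r. - real (Suc k) / r ^ (k + 2))"
proof -
  have pos: "sqdist p x > 0" if "x \<in> U" for x
    using that assms by (auto simp: sqdist_pos_iff)
  have "((\<lambda>r. 1 / r ^ Suc k) has_real_derivative - real (Suc k) / sqdist p x ^ (k + 2))
      (at (sqdist p x))" if "x \<in> U" for x
    using DERIV_inverse_fun[OF DERIV_pow[of "Suc k" "sqdist p x" UNIV]] pos[OF that]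
    by (auto elim!: DERIV_cong simp: inverse_eq_divide field_simps simp del: of_nat_Suc)
  then show "\<forall>x\<in>U. ((\<lambda>r. 1 / r ^ Suc k) has_real_derivative - real (Suc k) / sqdist p x ^ (k + 2))
      (at (sqdist p x))"
    by blast
  show "continuous_on (sqdist p ` U) (\<lambda>r. - real (Suc k) / r ^ (k + 2))"
    using pos by (force intro!: continuous_intros)
qed

text \<open>The bookkeeping behind \<open>carleman_field\<close>. Each letter stands for the value at one point: \<open>r\<close> for
  \<open>\<rho>\<close>, \<open>E\<close> for \<open>E w\<close>, \<open>L\<close> for \<open>\<Delta> w\<close>, \<open>Q\<close> for \<open>\<bar>\<nabla> w\<bar>\<^sup>2\<close>, \<open>W\<close> for \<open>w\<close>. With \<open>c = 4 - n / 2\<close> the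
  coefficients \<open>3 - n / 2\<close> and \<open>- c\<close> of \<open>Q / r\<^sup>2\<close> add up to \<open>- 1\<close>.\<close>

lemma carleman_field_algebra:
  fixes r \<tau> n c E L Q W :: real
  assumes "r > 0" "c = 4 - n / 2"
  shows "8 * \<tau> * (1 / r ^ Suc 1 * (E * L + (1 - n / 2) * Q)
        + (- real (Suc 1) / r ^ (1 + 2)) * (2 * E^2 - r * Q))
      - 8 * \<tau> * c * (1 / r ^ Suc 1 * (W * L + Q) + 2 * (- real (Suc 1) / r ^ (1 + 2)) * W * E)
      - 16 * \<tau> * c * ((n * (1 / r ^ Suc 2) + 2 * r * (- real (Suc 2) / r ^ (2 + 2))) * W^2
        + 2 * (1 / r ^ Suc 2) * W * E)
      + 16 * \<tau>^3 * ((n * (1 / r ^ Suc 4) + 2 * r * (- real (Suc 4) / r ^ (4 + 2))) * W^2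
        + 2 * (1 / r ^ Suc 4) * W * E)
    = 2 * (L + 4 * \<tau>^2 * W / r ^ 3) * (4 * \<tau> / r^2 * (E - c * W))
      - 8 * \<tau> * (4 * E^2 / r ^ 3 + Q / r^2 + (8 - n) * (n - 6) * W^2 / r ^ 3)
      - 32 * \<tau>^3 * W^2 / r ^ 5"
  using assms(1) unfolding assms(2) by (simp add: field_simps eval_nat_numeral)

text \<open>The commutator computation: the product of the two parts of the conjugated Laplacian is the
  divergence of an explicit field plus a quadratic form whose leading coefficients are positive.
  The constant \<open>4 - n / 2\<close> in the second factor shifts positivity between \<open>\<bar>\<nabla> w\<bar>\<^sup>2\<close> and
  \<open>\<tau>\<^sup>2 w\<^sup>2\<close>; with it both are positive, although the Hessian of the weight \<open>1 / \<rho>\<close> is negative in the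
  directions tangential to spheres.\<close>

lemma carleman_field:
  fixes U :: "(real^'n) set" and \<tau> :: real
  assumes U: "open U" and p: "p \<notin> U" and w: "C2_on U w"
  obtains V where "\<And>j. C1_on U (V j)"
    "\<And>j x. w x = 0 \<Longrightarrow> gradient w x = 0 \<Longrightarrow> V j x = 0"
    "\<And>x. x \<in> U \<Longrightarrow> divergence V x =
      2 * (laplacian w x + 4 * \<tau>^2 * w x / sqdist p x ^ 3)
        * (4 * \<tau> / (sqdist p x)^2 * ((x - p) \<bullet> gradient w x - (4 - CARD('n) / 2) * w x))
      - 8 * \<tau> * (4 * ((x - p) \<bullet> gradient w x)^2 / sqdist p x ^ 3
        + (gradient w x \<bullet> gradient w x) / (sqdist p x)^2
        + (8 - real CARD('n)) * (real CARD('n) - 6) * (w x)^2 / sqdist p x ^ 3)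
      - 32 * \<tau>^3 * (w x)^2 / sqdist p x ^ 5"
proof -
  define c where "c = 4 - real CARD('n) / 2"
  \<comment> \<open>The coefficients are \<open>\<rho>\<close> to the powers \<open>- 2\<close>, \<open>- 2\<close>, \<open>- 3\<close> and \<open>- 5\<close>; the field \<open>V3\<close> removes the mixed
    term \<open>w (E w) / \<rho>\<^sup>3\<close> that \<open>V2\<close> creates.\<close>
  define V1 where "V1 j x = 1 / sqdist p x ^ Suc 1 * (((x - p) \<bullet> gradient w x) * partial_deriv j w x
      - (x - p) $ j * ((1/2) * (gradient w x \<bullet> gradient w x)))" for j x
  define V2 where "V2 j x = 1 / sqdist p x ^ Suc 1 * (w x * partial_deriv j w x)" for j x
  define V3 where "V3 j x = 1 / sqdist p x ^ Suc 2 * ((x - p) $ j * (w x * w x))" for j x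
  define V5 where "V5 j x = 1 / sqdist p x ^ Suc 4 * ((x - p) $ j * (w x * w x))" for j x
  note d1 = divergence_euler_gradient[OF U w inverse_power_sqdist_derivative[OF p, where k = 1], folded V1_def]
  note d2 = divergence_function_gradient[OF U w inverse_power_sqdist_derivative[OF p, where k = 1], folded V2_def]
  note d3 = divergence_position_square[OF U w inverse_power_sqdist_derivative[OF p, where k = 2], folded V3_def]
  note d5 = divergence_position_square[OF U w inverse_power_sqdist_derivative[OF p, where k = 4], folded V5_def]
  define V where "V j x = (8 * \<tau>) * V1 j x + (- 8 * \<tau> * c) * V2 j x + (- 16 * \<tau> * c) * V3 j x
    + (16 * \<tau>^3) * V5 j x" for j x
  show ?thesis
  proof
    show "C1_on U (V j)" for j
      unfolding V_def by (intro C1_on_add C1_on_mult C1_on_const d1(1) d2(1) d3(1) d5(1))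
    show "V j x = 0" if "w x = 0" "gradient w x = 0" for j x
      using that by (simp add: V_def V1_def V2_def V3_def V5_def)
    fix x assume x: "x \<in> U"
    define r where "r = sqdist p x"
    have r: "r > 0" using x p by (auto simp: r_def sqdist_pos_iff)
    have scaled: "has_partial j (\<lambda>x. a * F x) (a * d) x" if "has_partial j F d x"
      for a d F and j :: 'n
      using has_partial_mult[OF has_partial_const[of j a x] that] by (simp add: mult.commute)
    have "has_partial j (V j) (8 * \<tau> * partial_deriv j (V1 j) x
        + - 8 * \<tau> * c * partial_deriv j (V2 j) x + - 16 * \<tau> * c * partial_deriv j (V3 j) x
        + 16 * \<tau>^3 * partial_deriv j (V5 j) x) x" for j
      unfolding V_def
      by (intro has_partial_add scaled C1_on_has_partial[OF d1(1) x] C1_on_has_partial[OF d2(1) x]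
          C1_on_has_partial[OF d3(1) x] C1_on_has_partial[OF d5(1) x])
    from divergence_eqI[of V, OF this] have "divergence V x
        = 8 * \<tau> * divergence V1 x - 8 * \<tau> * c * divergence V2 x
        - 16 * \<tau> * c * divergence V3 x + 16 * \<tau>^3 * divergence V5 x"
      by (simp add: divergence_def sum.distrib sum_subtractf sum_distrib_left)
    then show "divergence V x =
      2 * (laplacian w x + 4 * \<tau>^2 * w x / sqdist p x ^ 3)
        * (4 * \<tau> / (sqdist p x)^2 * ((x - p) \<bullet> gradient w x - (4 - CARD('n) / 2) * w x))
      - 8 * \<tau> * (4 * ((x - p) \<bullet> gradient w x)^2 / sqdist p x ^ 3
        + (gradient w x \<bullet> gradient w x) / (sqdist p x)^2
        + (8 - real CARD('n)) * (real CARD('n) - 6) * (w x)^2 / sqdist p x ^ 3)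
      - 32 * \<tau>^3 * (w x)^2 / sqdist p x ^ 5"
      unfolding d1(2)[OF x] d2(2)[OF x] d3(2)[OF x] d5(2)[OF x] r_def[symmetric]
        carleman_field_algebra[OF r c_def]
      unfolding c_def .
  qed
qed

lemma set_integrable_continuous_compact:
  fixes f :: "real^'n \<Rightarrow> real"
  assumes "compact K" "continuous_on K f"
  shows "set_integrable lborel K f"
  unfolding set_integrable_def by (rule borel_integrable_compact[OF assms])

text \<open>The pointwise part of the estimate, for \<open>w = e\<^bsup>\<tau>/\<rho>\<^esup> v\<close> and \<open>f = e\<^bsup>\<tau>/\<rho>\<^esup> \<Delta> v\<close> (with \<open>Q = \<bar>\<nabla> w\<bar>\<^sup>2\<close>
  and \<open>Qv = e\<^bsup>2\<tau>/\<rho>\<^esup> \<bar>\<nabla> v\<bar>\<^sup>2\<close>). Three error terms are compared with \<open>32 \<tau>\<^sup>3 w\<^sup>2 / r\<^sup>5\<close>: twice the square of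
  \<open>8 \<tau> w / r\<^sup>2\<close>, the term with the coefficient \<open>(8 - n) (n - 6)\<close>, which may be negative, and the
  price of passing from \<open>\<nabla> w\<close> to \<open>\<nabla> v\<close>. Each of them costs at most \<open>8 \<tau>\<^sup>3 w\<^sup>2 / r\<^sup>5\<close>, so one quarter
  of the main term is left.\<close>

lemma carleman_absorption:
  fixes r R \<tau> n f w Q Qv D :: real
  assumes r: "0 < r" "r \<le> R" and \<tau>: "\<tau> \<ge> (16 + \<bar>(8 - n) * (n - 6)\<bar>) * R"
    and D: "D \<le> (f - 8 * \<tau> * w / r^2)^2 - 8 * \<tau> * (Q / r^2 + (8 - n) * (n - 6) * w^2 / r^3)
      - 32 * \<tau>^3 * w^2 / r^5"
    and Qv: "Qv \<le> 2 * Q + 8 * \<tau>^2 * w^2 / r^3" and Q: "0 \<le> Q"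
  shows "\<tau> * Qv / r^2 + 8 * \<tau>^3 * w^2 / r^5 - 2 * f^2 \<le> - D"
proof -
  define k where "k = (8 - n) * (n - 6)"
  have R: "0 < R" using r by linarith
  have "16 * R \<le> (16 + \<bar>k\<bar>) * R" "\<bar>k\<bar> * R \<le> (16 + \<bar>k\<bar>) * R" "1 * R \<le> (16 + \<bar>k\<bar>) * R"
    using R by (auto intro!: mult_right_mono)
  then have t: "16 * r \<le> \<tau>" "\<bar>k\<bar> * R \<le> \<tau>" "R \<le> \<tau>" "0 < \<tau>"
    using \<tau> r R unfolding k_def by linarith+
  have "\<bar>k\<bar> * r * r \<le> \<tau> * \<tau>"
    using t r R by (intro mult_mono order_trans[OF mult_left_mono[OF r(2)] t(2)]) auto
  then have 1: "8 * \<tau> * (\<bar>k\<bar> * r * r) \<le> 8 * \<tau> * (\<tau> * \<tau>)"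
    using t by (intro mult_left_mono) auto
  have 2: "8 * \<tau> * \<tau> * (16 * r) \<le> 8 * \<tau> * \<tau> * \<tau>"
    using t by (intro mult_left_mono) auto
  have kw: "- k * w^2 / r^3 \<le> \<bar>k\<bar> * r * r * (w^2 / r^5)"
    using r by (simp add: field_simps eval_nat_numeral abs_if mult_right_mono)
  have "(f - 8 * \<tau> * w / r^2)^2 \<le> 2 * f^2 + 2 * (8 * \<tau> * w / r^2)^2"
    using sum_squares_bound[of f "- (8 * \<tau> * w / r^2)"] by (simp add: power2_diff)
  also have "2 * (8 * \<tau> * w / r^2)^2 = 8 * \<tau> * \<tau> * (16 * r) * (w^2 / r^5)"
    using r by (simp add: field_simps eval_nat_numeral)
  also have "\<dots> \<le> 8 * \<tau> * \<tau> * \<tau> * (w^2 / r^5)"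
    using 2 r by (intro mult_right_mono) auto
  finally have sq: "(f - 8 * \<tau> * w / r^2)^2 \<le> 2 * f^2 + 8 * \<tau> * \<tau> * \<tau> * (w^2 / r^5)"
    by simp
  have "8 * \<tau> * (- k * w^2 / r^3) \<le> 8 * \<tau> * (\<bar>k\<bar> * r * r * (w^2 / r^5))"
    using kw t by (intro mult_left_mono) auto
  also have "\<dots> = 8 * \<tau> * (\<bar>k\<bar> * r * r) * (w^2 / r^5)"
    by (simp only: mult.assoc)
  also have "\<dots> \<le> 8 * \<tau> * (\<tau> * \<tau>) * (w^2 / r^5)"
    using 1 r by (intro mult_right_mono) auto
  finally have kt: "8 * \<tau> * (- k * w^2 / r^3) \<le> 8 * \<tau> * \<tau> * \<tau> * (w^2 / r^5)"
    by (simp only: mult.assoc)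
  have "\<tau> * Qv / r^2 \<le> \<tau> * (2 * Q + 8 * \<tau>^2 * w^2 / r^3) / r^2"
    using Qv t r by (intro divide_right_mono mult_left_mono) auto
  also have "\<dots> = 2 * (\<tau> * Q / r^2) + 8 * \<tau> * \<tau> * \<tau> * (w^2 / r^5)"
    using r by (simp add: field_simps eval_nat_numeral)
  finally have qv: "\<tau> * Qv / r^2 \<le> 2 * (\<tau> * Q / r^2) + 8 * \<tau> * \<tau> * \<tau> * (w^2 / r^5)" .
  have Qpos: "0 \<le> \<tau> * Q / r^2"
    using t Q by simp
  have D': "D \<le> (f - 8 * \<tau> * w / r^2)^2 - 8 * (\<tau> * Q / r^2) + 8 * \<tau> * (- k * w^2 / r^3)
      - 32 * \<tau> * \<tau> * \<tau> * (w^2 / r^5)"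
    using D unfolding k_def[symmetric] by (simp add: algebra_simps power3_eq_cube)
  have "8 * \<tau>^3 * w^2 / r^5 = 8 * \<tau> * \<tau> * \<tau> * (w^2 / r^5)"
    by (simp add: power3_eq_cube)
  then show ?thesis
    using D' sq kt qv Qpos by linarith
qed

text \<open>Conjugating the Laplacian with \<open>e\<^bsup>\<tau>/\<rho>\<^esup>\<close>: the left-hand side is the expansion of \<open>\<Delta> (e\<^bsup>\<tau>/\<rho>\<^esup> v)\<close>
  followed by the remaining terms of \<open>S + A\<close>.\<close>

lemma conjugated_laplacian_algebra:
  fixes r \<tau> n e E L Qv v f w E' :: real
  assumes "r > 0" and w: "w = e * v"
    and E': "E' = e * E - 2 * \<tau> / r * w"
    and f: "f = e * L"
  shows "e * L + 4 * (- \<tau> / r^2 * e) * E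
        + (4 * r * ((2 * \<tau> / r^3 + \<tau>^2 / r^4) * e) + 2 * n * (- \<tau> / r^2 * e)) * v
        + 4 * \<tau>^2 * w / r ^ 3 + 4 * \<tau> / r^2 * (E' - (4 - n / 2) * w)
    = f - 8 * \<tau> * w / r^2"
  using assms(1) unfolding E' f w by (simp add: field_simps eval_nat_numeral)

text \<open>The estimate for \<open>v\<close> supported in \<open>K\<close>. It is stated as a single integral, so that it can be
  compared with a pointwise lower bound of the integrand.\<close>

theorem carleman_estimate:
  fixes U K :: "(real^'n) set" and v :: "real^'n \<Rightarrow> real" and \<tau> R :: real
  assumes U: "open U" "p \<notin> U" and K: "compact K" "K \<subseteq> U" "\<And>x. x \<in> K \<Longrightarrow> sqdist p x \<le> R"
    and v: "C2_on U v" "\<And>x. x \<notin> K \<Longrightarrow> v x = 0"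
    and \<tau>: "\<tau> \<ge> (16 + \<bar>(8 - real CARD('n)) * (real CARD('n) - 6)\<bar>) * R"
  shows "(LINT x:K|lborel. exp (2 * \<tau> / sqdist p x) *
      (\<tau> * (gradient v x \<bullet> gradient v x) / (sqdist p x)^2 + 8 * \<tau>^3 * (v x)^2 / sqdist p x ^ 5
        - 2 * (laplacian v x)^2)) \<le> 0"
proof -
  define h h' h'' where "h r = exp (\<tau> / r)" and "h' r = - \<tau> / r^2 * exp (\<tau> / r)"
    and "h'' r = (2 * \<tau> / r^3 + \<tau>^2 / r^4) * exp (\<tau> / r)" for r
  have pos: "sqdist p x > 0" if "x \<in> U" for x
    using that U by (auto simp: sqdist_pos_iff)
  have h: "(h has_real_derivative h' (sqdist p x)) (at (sqdist p x))"
    and h': "(h' has_real_derivative h'' (sqdist p x)) (at (sqdist p x))" if "x \<in> U" for x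
    unfolding h_def[abs_def] h'_def[abs_def] h''_def using pos[OF that]
    by (auto intro!: derivative_eq_intros simp: field_simps eval_nat_numeral)
  have h'': "continuous_on (sqdist p ` U) h''"
    unfolding h''_def[abs_def] using pos by (force intro!: continuous_intros)
  define w where "w x = h (sqdist p x) * v x" for x
  have w: "C2_on U w"
    unfolding w_def[abs_def] by (rule C2_on_radial_mult[OF U(1) v(1) h h' h''])
  have w0: "w x = 0" "gradient w x = 0" if "x \<notin> K" for x
  proof -
    have "w y = 0" if "y \<notin> K" for y
      using v(2) that by (simp add: w_def)
    then show "w x = 0" "gradient w x = 0"
      using partial_deriv_eqI[OF has_partial_zero_off_closed[OF compact_imp_closed[OF K(1)] that]]
        that by (auto simp: gradient_def vec_eq_iff)
  qed
  obtain V where V: "\<And>j. C1_on U (V j)" "\<And>j x. w x = 0 \<Longrightarrow> gradient w x = 0 \<Longrightarrow> V j x = 0"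
    and div: "\<And>x. x \<in> U \<Longrightarrow> divergence V x =
      2 * (laplacian w x + 4 * \<tau>^2 * w x / sqdist p x ^ 3)
        * (4 * \<tau> / (sqdist p x)^2 * ((x - p) \<bullet> gradient w x - (4 - CARD('n) / 2) * w x))
      - 8 * \<tau> * (4 * ((x - p) \<bullet> gradient w x)^2 / sqdist p x ^ 3
        + (gradient w x \<bullet> gradient w x) / (sqdist p x)^2
        + (8 - real CARD('n)) * (real CARD('n) - 6) * (w x)^2 / sqdist p x ^ 3)
      - 32 * \<tau>^3 * (w x)^2 / sqdist p x ^ 5"
    using carleman_field[OF U w] by blast
  have V0: "V j x = 0" if "x \<notin> K" for j x
    using V(2) w0 that by blast
  note int_div = integral_divergence_eq_0[OF U(1) K(1,2) V(1) V0]
  have pointwise: "exp (2 * \<tau> / sqdist p x) *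
      (\<tau> * (gradient v x \<bullet> gradient v x) / (sqdist p x)^2 + 8 * \<tau>^3 * (v x)^2 / sqdist p x ^ 5
        - 2 * (laplacian v x)^2) \<le> - divergence V x" if "x \<in> K" for x
  proof -
    have x: "x \<in> U" using that K by blast
    define r where "r = sqdist p x"
    have r: "0 < r" "r \<le> R" using pos[OF x] K(3)[OF that] by (auto simp: r_def)
    define e where "e = exp (\<tau> / r)"
    have e: "e > 0" by (simp add: e_def)
    have e2: "exp (2 * \<tau> / r) = e^2"
      by (simp add: e_def flip: exp_double)
    define L where "L = laplacian v x"
    define f where "f = e * L"
    define Qv where "Qv = gradient v x \<bullet> gradient v x"
    define Q where "Q = gradient w x \<bullet> gradient w x"
    define E where "E = (x - p) \<bullet> gradient w x"
    have XX: "(x - p) \<bullet> (x - p) = r" by (simp add: r_def sqdist_def)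
    have wx: "w x = e * v x" by (simp add: w_def h_def e_def r_def)
    have "gradient w x = h r *\<^sub>R gradient v x + (2 * h' r * v x) *\<^sub>R (x - p)"
      unfolding w_def[abs_def] r_def by (rule gradient_radial_mult[OF U(1) v(1) h h' h'' x])
    also have "2 * h' r * v x = - (2 * \<tau> / r^2) * w x"
      by (simp add: h'_def wx e_def)
    finally have grad: "gradient w x = e *\<^sub>R gradient v x - (2 * \<tau> / r^2 * w x) *\<^sub>R (x - p)"
      by (simp add: h_def e_def)
    have E: "E = e * ((x - p) \<bullet> gradient v x) - 2 * \<tau> / r * w x"
      unfolding E_def grad using r XX by (simp add: inner_diff_right power2_eq_square)
    have lap: "laplacian w x = e * L + 4 * (- \<tau> / r^2 * e) * ((x - p) \<bullet> gradient v x)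
        + (4 * r * ((2 * \<tau> / r^3 + \<tau>^2 / r^4) * e) + 2 * real CARD('n) * (- \<tau> / r^2 * e)) * v x"
      unfolding w_def[abs_def] e_def L_def
      using laplacian_radial_mult[OF U(1) v(1) h h' h'' x] unfolding r_def[symmetric]
      by (simp add: h_def h'_def h''_def)
    define S where "S = laplacian w x + 4 * \<tau>^2 * w x / r ^ 3"
    define A where "A = 4 * \<tau> / r^2 * (E - (4 - CARD('n) / 2) * w x)"
    have SA: "S + A = f - 8 * \<tau> * w x / r^2"
      unfolding S_def A_def lap
      by (rule conjugated_laplacian_algebra[OF r(1) wx E f_def])
    have "2 * S * A \<le> (f - 8 * \<tau> * w x / r^2)^2"
      unfolding SA[symmetric] by (simp add: power2_sum)
    moreover have "0 < \<tau>"
    proof -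
      have "0 < (16 + \<bar>(8 - real CARD('n)) * (real CARD('n) - 6)\<bar>) * R"
        using r by (intro mult_pos_pos) auto
      then show ?thesis using \<tau> by linarith
    qed
    then have "0 \<le> 8 * \<tau> * (4 * E^2 / r^3)"
      using r by simp
    ultimately have D: "divergence V x \<le> (f - 8 * \<tau> * w x / r^2)^2
        - 8 * \<tau> * (Q / r^2 + (8 - real CARD('n)) * (real CARD('n) - 6) * (w x)^2 / r ^ 3)
        - 32 * \<tau>^3 * (w x)^2 / r ^ 5"
      unfolding div[OF x] r_def[symmetric] E_def[symmetric] Q_def[symmetric]
        S_def[symmetric] A_def[symmetric]
      by (simp add: distrib_left)
    \<comment> \<open>Passing from \<open>\<nabla> w\<close> to \<open>\<nabla> v\<close> costs a term with a factor \<open>\<tau>\<close>, which the term in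
      \<open>\<tau>\<^sup>3 w\<^sup>2\<close> can pay for.\<close>
    have "e *\<^sub>R gradient v x = gradient w x + (2 * \<tau> / r^2 * w x) *\<^sub>R (x - p)"
      by (simp add: grad)
    then have "norm (e *\<^sub>R gradient v x) \<le> norm (gradient w x) + norm ((2 * \<tau> / r^2 * w x) *\<^sub>R (x - p))"
      by (simp only: norm_triangle_ineq)
    then have "(norm (e *\<^sub>R gradient v x))^2
        \<le> (norm (gradient w x) + norm ((2 * \<tau> / r^2 * w x) *\<^sub>R (x - p)))^2"
      by (rule power_mono) simp
    also have "\<dots> \<le> 2 * (norm (gradient w x))^2 + 2 * (norm ((2 * \<tau> / r^2 * w x) *\<^sub>R (x - p)))^2"
      using sum_squares_bound[of "norm (gradient w x)" "norm ((2 * \<tau> / r^2 * w x) *\<^sub>R (x - p))"]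
      by (simp add: power2_sum)
    also have "(norm ((2 * \<tau> / r^2 * w x) *\<^sub>R (x - p)))^2 = 4 * \<tau>^2 * (w x)^2 / r^3"
      unfolding norm_scaleR power_mult_distrib norm_diff_power2_eq_sqdist r_def[symmetric]
      using r by (simp add: field_simps eval_nat_numeral)
    finally have "e^2 * Qv \<le> 2 * Q + 8 * \<tau>^2 * (w x)^2 / r^3"
      by (simp add: Qv_def Q_def power_mult_distrib flip: power2_norm_eq_inner)
    from carleman_absorption[OF r \<tau> D this]
    have "\<tau> * (e^2 * Qv) / r^2 + 8 * \<tau>^3 * (w x)^2 / r^5 - 2 * f^2 \<le> - divergence V x"
      by (simp add: Q_def)
    then show ?thesis
      unfolding r_def[symmetric] e2 Qv_def[symmetric] L_def[symmetric]
      by (simp add: wx f_def power_mult_distrib algebra_simps)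
  qed
  have "continuous_on K (\<lambda>x. exp (2 * \<tau> / sqdist p x) *
      (\<tau> * (gradient v x \<bullet> gradient v x) / (sqdist p x)^2 + 8 * \<tau>^3 * (v x)^2 / sqdist p x ^ 5
        - 2 * (laplacian v x)^2))"
    using pos K(2)
    by (intro continuous_intros continuous_on_sqdist
      continuous_on_subset[OF C2_on_imp_continuous_on_gradient_laplacian(1)[OF v(1)]]
      continuous_on_subset[OF C2_on_imp_continuous_on_gradient_laplacian(2)[OF v(1)]]
      continuous_on_subset[OF C1_on_imp_continuous_on[OF C2_on_imp_C1_on[OF v(1)]]])
      (auto simp: less_imp_neq[symmetric] subset_iff)
  then have "set_integrable lborel K (\<lambda>x. exp (2 * \<tau> / sqdist p x) *
      (\<tau> * (gradient v x \<bullet> gradient v x) / (sqdist p x)^2 + 8 * \<tau>^3 * (v x)^2 / sqdist p x ^ 5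
        - 2 * (laplacian v x)^2))"
    by (rule set_integrable_continuous_compact[OF K(1)])
  moreover have "set_integrable lborel K (\<lambda>x. - divergence V x)"
    using set_integrable_mult_right[OF int_div(1), of "- 1"] by simp
  ultimately have "(LINT x:K|lborel. exp (2 * \<tau> / sqdist p x) *
      (\<tau> * (gradient v x \<bullet> gradient v x) / (sqdist p x)^2 + 8 * \<tau>^3 * (v x)^2 / sqdist p x ^ 5
        - 2 * (laplacian v x)^2)) \<le> (LINT x:K|lborel. - divergence V x)"
    by (rule set_integral_mono) (rule pointwise)
  also have "\<dots> = 0"
    using int_div by (simp add: set_integral_uminus)
  finally show ?thesis .
qed

section \<open>Unique continuation across balls\<close>

text \<open>The cutoff is \<open>max 0 (t - s)\<close> cubed, the least integral power of the positive part that is twice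
  continuously differentiable.\<close>

lemma power_positive_part_derivative:
  fixes s t :: real
  shows "((\<lambda>s. (max 0 (t - s))^(k+2)) has_real_derivative - real (k+2) * (max 0 (t - s))^(k+1)) (at s)"
proof -
  have *: "((\<lambda>s::real. (max 0 s)^(k+2)) has_real_derivative real (k+2) * (max 0 y)^(k+1)) (at y)" for y
  proof -
    consider "y < 0" | "y = 0" | "y > 0" by linarith
    then show ?thesis
    proof cases
      case 1
      have "((\<lambda>s::real. 0) has_real_derivative real (k+2) * (max 0 y)^(k+1)) (at y)"
        using 1 by simp
      then show ?thesis
        by (rule has_field_derivative_transform_within_open[of _ _ _ "{..<0}"]) (use 1 in auto)
    next
      case 2
      have "((\<lambda>h::real. (max 0 h)^(k+1)) \<longlongrightarrow> (max 0 0)^(k+1)) (at 0)"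
        by (intro tendsto_intros)
      moreover have "\<forall>\<^sub>F h in at (0::real). (max 0 h)^(k+1) = (max 0 (0 + h)^(k+2) - max 0 0^(k+2)) / h"
        by (auto simp: eventually_at_filter max_def intro!: always_eventually)
      ultimately show ?thesis
        using 2 Lim_transform_eventually unfolding DERIV_def by fastforce
    next
      case 3
      have "((\<lambda>s::real. s^(k+2)) has_real_derivative real (k+2) * (max 0 y)^(k+1)) (at y)"
        using 3 DERIV_pow[of "k + 2" y UNIV] by simp
      then show ?thesis
        by (rule has_field_derivative_transform_within_open[of _ _ _ "{0<..}"]) (use 3 in auto)
    qed
  qed
  show ?thesis
    by (rule DERIV_cong[OF DERIV_chain2[OF *]]) (auto intro!: derivative_eq_intros)
qed


text \<open>The differential inequality is inherited by \<open>v = m\<^sup>3 u\<close> wherever the cutoff satisfies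
  \<open>m \<ge> d > 0\<close>, because there the lower powers of \<open>m\<close> that come from differentiating the cutoff are
  bounded by multiples of \<open>m\<^sup>3\<close>. Here \<open>a\<close>, \<open>g\<close>, \<open>L\<close>, \<open>E\<close> are the values of \<open>u\<close>, \<open>\<bar>\<nabla> u\<bar>\<close>, \<open>\<Delta> u\<close> and \<open>E u\<close>,
  and \<open>gv\<close> is that of \<open>\<bar>\<nabla> v\<bar>\<close>.\<close>

lemma cutoff_laplacian_bound:
  fixes d R M m a L g n E :: real
  assumes d: "0 < d" "d \<le> m" and R: "0 \<le> R" "r \<le> R^2" and M: "0 \<le> M" and n: "0 \<le> n"
    and r: "0 \<le> r"
    and L: "\<bar>L\<bar> \<le> M * (g + \<bar>a\<bar>)" and g: "0 \<le> g" and E: "\<bar>E\<bar> \<le> R * g"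
    and gv: "m^3 * g \<le> gv + 6 * m^2 * \<bar>a\<bar> * R"
  shows "\<bar>m^3 * L - 12 * m^2 * E + (24 * r * m - 6 * n * m^2) * a\<bar>
    \<le> (M + 12 * R / d) * gv
      + ((M + 12 * R / d) * (6 * R / d) + M + 24 * R^2 / d^2 + 6 * n / d) * \<bar>m^3 * a\<bar>"
proof -
  have m: "0 < m" using d by linarith
  have "d * m^2 \<le> m * m^2" "d^2 * m \<le> m^2 * m"
    using d m by (auto intro!: mult_right_mono power_mono)
  then have m2: "m^2 \<le> m^3 / d" and m1: "m \<le> m^3 / d^2"
    using d by (simp_all add: field_simps eval_nat_numeral)
  define v where "v = m^3 * \<bar>a\<bar>"
  have v: "\<bar>m^3 * a\<bar> = v" using m by (simp add: v_def abs_mult)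
  have v2: "m^2 * \<bar>a\<bar> \<le> v / d" and v1: "m * \<bar>a\<bar> \<le> v / d^2"
    using mult_right_mono[OF m2, of "\<bar>a\<bar>"] mult_right_mono[OF m1, of "\<bar>a\<bar>"] by (simp_all add: v_def)
  have "6 * R * (m^2 * \<bar>a\<bar>) \<le> 6 * R * (v / d)"
    using v2 R by (intro mult_left_mono) auto
  then have mg: "m^3 * g \<le> gv + 6 * R / d * v"
    using gv by (simp add: mult_ac)
  have t1: "\<bar>m^3 * L\<bar> \<le> M * (m^3 * g) + M * v"
    using mult_left_mono[OF L, of "m^3"] m by (simp add: abs_mult v_def algebra_simps)
  have "\<bar>12 * m^2 * E\<bar> \<le> 12 * m^2 * (R * g)"
    using mult_left_mono[OF E, of "12 * m^2"] by (simp add: abs_mult)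
  also have "\<dots> \<le> 12 * (m^3 / d) * (R * g)"
    using m2 R g by (intro mult_right_mono mult_left_mono) auto
  finally have t2: "\<bar>12 * m^2 * E\<bar> \<le> 12 * R / d * (m^3 * g)"
    by (simp add: mult_ac)
  have "\<bar>24 * r * m * a\<bar> = 24 * r * (m * \<bar>a\<bar>)"
    using r m by (simp add: abs_mult)
  also have "\<dots> \<le> 24 * R^2 * (v / d^2)"
    using v1 R r m by (intro mult_mono) auto
  finally have t3: "\<bar>24 * r * m * a\<bar> \<le> 24 * R^2 / d^2 * v"
    by simp
  have "\<bar>6 * n * m^2 * a\<bar> = 6 * n * (m^2 * \<bar>a\<bar>)"
    using n by (simp add: abs_mult)
  also have "\<dots> \<le> 6 * n * (v / d)"
    using v2 n by (intro mult_left_mono) auto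
  finally have t4: "\<bar>6 * n * m^2 * a\<bar> \<le> 6 * n / d * v"
    by simp
  have "\<bar>m^3 * L - 12 * m^2 * E + (24 * r * m - 6 * n * m^2) * a\<bar>
      \<le> \<bar>m^3 * L\<bar> + \<bar>12 * m^2 * E\<bar> + \<bar>24 * r * m * a\<bar> + \<bar>6 * n * m^2 * a\<bar>"
    unfolding left_diff_distrib by linarith
  also have "\<dots> \<le> (M + 12 * R / d) * (m^3 * g) + (M + 24 * R^2 / d^2 + 6 * n / d) * v"
    using t1 t2 t3 t4 by (simp add: distrib_right)
  also have "\<dots> \<le> (M + 12 * R / d) * (gv + 6 * R / d * v) + (M + 24 * R^2 / d^2 + 6 * n / d) * v"
    using mg M R d by (intro add_right_mono mult_left_mono) auto
  finally show ?thesis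
    unfolding v by (simp add: algebra_simps)
qed

text \<open>On the part \<open>\<rho> \<le> s\<close> of the support, where the weight is at least \<open>e\<^bsup>2\<tau>/s\<^esup>\<close>, the inequality lets
  at least half of \<open>8 \<tau>\<^sup>3 v\<^sup>2 / \<rho>\<^sup>5\<close> survive in the Carleman estimate. On the part \<open>\<rho> > s\<close> the function \<open>\<Delta> v\<close> is
  merely bounded, but the weight is at most \<open>e\<^bsup>2\<tau>/s\<^esup>\<close>. Dividing by that number leaves \<open>\<tau>\<^sup>3\<close> times the
  integral of \<open>v\<^sup>2\<close> over \<open>\<rho> \<le> s\<close> below a bound independent of \<open>\<tau>\<close>.\<close>

lemma sublevel_integral_eq_0:
  fixes U K :: "(real^'n) set" and v :: "real^'n \<Rightarrow> real" and A B s R :: real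
  assumes U: "open U" "p \<notin> U" and K: "compact K" "K \<subseteq> U" "\<And>x. x \<in> K \<Longrightarrow> sqdist p x \<le> R"
    and v: "C2_on U v" "\<And>x. x \<notin> K \<Longrightarrow> v x = 0"
    and s: "0 < s" and R: "0 < R" 
    and ineq: "\<And>x. x \<in> K \<Longrightarrow> sqdist p x \<le> s \<Longrightarrow>
      (laplacian v x)^2 \<le> A * (gradient v x \<bullet> gradient v x) + B * (v x)^2"
  shows "(LINT x:{x \<in> K. sqdist p x \<le> s}|lborel. (v x)^2) = 0"
proof -
  define S where "S = {x \<in> K. sqdist p x \<le> s}"
  have "closed {x. sqdist p x \<le> s}"
    by (intro closed_Collect_le continuous_on_sqdist continuous_on_const)
  moreover have "S = K \<inter> {x. sqdist p x \<le> s}"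
    by (auto simp: S_def)
  ultimately have S: "compact S" "S \<subseteq> K"
    using compact_Int_closed[OF K(1)] by auto
  have pos: "sqdist p x > 0" if "x \<in> K" for x
    using that U K by (auto simp: sqdist_pos_iff)
  have cont_v: "continuous_on K v"
    using C1_on_imp_continuous_on[OF C2_on_imp_C1_on[OF v(1)]] K(2) continuous_on_subset by blast
  have cont_L: "continuous_on K (laplacian v)"
    using C2_on_imp_continuous_on_gradient_laplacian(2)[OF v(1)] K(2) continuous_on_subset by blast
  have cont_Q: "continuous_on K (\<lambda>x. gradient v x \<bullet> gradient v x)"
    using C2_on_imp_continuous_on_gradient_laplacian(1)[OF v(1)] K(2) continuous_on_subset by blast
  have "compact (laplacian v ` K)"
    using compact_continuous_image[OF cont_L K(1)] .
  then obtain H where H: "\<And>x. x \<in> K \<Longrightarrow> \<bar>laplacian v x\<bar> \<le> H"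
    using compact_imp_bounded bounded_iff by (metis imageI real_norm_def)
  define J where "J = (LINT x:S|lborel. (v x)^2)"
  have int_v: "set_integrable lborel S (\<lambda>x. (v x)^2)"
    by (rule set_integrable_continuous_compact[OF S(1)])
      (intro continuous_intros continuous_on_subset[OF cont_v S(2)])
  have ind: "(\<lambda>x. indicator K x *\<^sub>R (indicator S x * (v x)^2)) = (\<lambda>x. indicator S x *\<^sub>R (v x)^2)"
    using S(2) by (auto simp: fun_eq_iff indicator_def)
  have int_ind: "set_integrable lborel K (\<lambda>x. indicator S x * (v x)^2)"
    "(LINT x:K|lborel. indicator S x * (v x)^2) = J"
    using int_v unfolding J_def set_integrable_def set_lebesgue_integral_def ind by auto
  have "0 \<le> J"
    unfolding J_def set_lebesgue_integral_def by (intro integral_nonneg_AE AE_I2) simp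
  define N where "N = (16 + \<bar>(8 - real CARD('n)) * (real CARD('n) - 6)\<bar>) * R"
  \<comment> \<open>Beyond \<open>T\<close> the Carleman estimate holds and twice \<open>A \<bar>\<nabla> v\<bar>\<^sup>2 + B v\<^sup>2\<close> is absorbed.\<close>
  define T where "T = max (max N 1) (max (2 * A * R^2) (B * R^5))"
  define C where "C = 2 * H^2 * measure lborel K"
  have main: "4 * \<tau>^3 / R^5 * J \<le> C" if \<tau>: "\<tau> \<ge> T" for \<tau>
  proof -
    have t: "N \<le> \<tau>" "1 \<le> \<tau>" "2 * A * R^2 \<le> \<tau>" "B * R^5 \<le> \<tau>"
      using \<tau> by (auto simp: T_def)
    define F where "F x = exp (2 * \<tau> / sqdist p x) *
      (\<tau> * (gradient v x \<bullet> gradient v x) / (sqdist p x)^2 + 8 * \<tau>^3 * (v x)^2 / sqdist p x ^ 5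
        - 2 * (laplacian v x)^2)" for x
    define e where "e = exp (2 * \<tau> / s)"
    have e: "0 < e" by (simp add: e_def)
    have carl: "(LINT x:K|lborel. F x) \<le> 0"
      unfolding F_def by (rule carleman_estimate[OF U K v t(1)[unfolded N_def]])
    have lower: "e * (4 * \<tau>^3 / R^5 * (indicator S x * (v x)^2) - 2 * H^2) \<le> F x" if x: "x \<in> K" for x
    proof -
      define r where "r = sqdist p x"
      have r: "0 < r" "r \<le> R" using pos[OF x] K(3)[OF x] by (auto simp: r_def)
      define Q where "Q = gradient v x \<bullet> gradient v x"
      define L where "L = laplacian v x"
      have Q: "0 \<le> Q" by (simp add: Q_def)
      have F: "F x = exp (2 * \<tau> / r) * (\<tau> * Q / r^2 + 8 * \<tau>^3 * (v x)^2 / r^5 - 2 * L^2)"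
        by (simp add: F_def r_def Q_def L_def)
      show ?thesis
      proof (cases "r \<le> s")
        case True
        have "x \<in> S" using True x by (simp add: S_def r_def)
        have "2 * A * Q \<le> \<tau> * Q / r^2"
        proof -
          have "2 * A * Q * r^2 \<le> \<tau> * Q"
          proof (cases "A \<ge> 0")
            case True
            have "2 * A * r^2 \<le> 2 * A * R^2"
              using r True by (intro mult_left_mono power_mono) auto
            then have "2 * A * r^2 * Q \<le> \<tau> * Q"
              using t Q by (intro mult_right_mono) auto
            then show ?thesis by (simp add: mult_ac)
          next
            case False
            then have "2 * A * Q * r^2 \<le> 0"
              using Q by (simp add: mult_nonpos_nonneg)
            also have "0 \<le> \<tau> * Q" using Q t by simp
            finally show ?thesis .
          qed
          then show ?thesis using r by (simp add: field_simps)
        qed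
        moreover have "2 * B * (v x)^2 \<le> 2 * \<tau>^3 * (v x)^2 / R^5"
        proof -
          have "\<tau>^1 \<le> \<tau>^3" using t by (intro power_increasing) auto
          then have "B * R^5 \<le> \<tau>^3" using t by simp
          then have "2 * (v x)^2 * (B * R^5) \<le> 2 * (v x)^2 * \<tau>^3"
            by (intro mult_left_mono) auto
          then show ?thesis using R by (simp add: field_simps)
        qed
        moreover have "8 * \<tau>^3 * (v x)^2 / R^5 \<le> 8 * \<tau>^3 * (v x)^2 / r^5"
          using r t by (intro divide_left_mono power_mono mult_nonneg_nonneg) auto
        moreover have "L^2 \<le> A * Q + B * (v x)^2"
          using ineq[OF x] True by (simp add: L_def Q_def r_def)
        moreover have "0 \<le> \<tau>^3 * (v x)^2 / R^5" using t R by simp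
        ultimately have low: "4 * \<tau>^3 / R^5 * (v x)^2 \<le> \<tau> * Q / r^2 + 8 * \<tau>^3 * (v x)^2 / r^5 - 2 * L^2"
          by simp
        have "e \<le> exp (2 * \<tau> / r)"
          unfolding e_def using True r t s by (simp add: divide_left_mono)
        then have "e * (4 * \<tau>^3 / R^5 * (v x)^2) \<le> F x"
          unfolding F using low e R t by (intro mult_mono) auto
        moreover have "0 \<le> e * (2 * H^2)" using e by simp
        ultimately show ?thesis using \<open>x \<in> S\<close> by (simp add: right_diff_distrib)
      next
        case False
        have "L^2 \<le> H^2"
          using power_mono[OF H[OF x], of 2] by (simp add: L_def)
        moreover have "0 \<le> \<tau> * Q / r^2" "0 \<le> 8 * \<tau>^3 * (v x)^2 / r^5"
          using Q r t by simp_all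
        ultimately have "- 2 * H^2 \<le> \<tau> * Q / r^2 + 8 * \<tau>^3 * (v x)^2 / r^5 - 2 * L^2"
          by linarith
        then have "exp (2 * \<tau> / r) * (- 2 * H^2) \<le> F x"
          unfolding F by (intro mult_left_mono) auto
        moreover have "exp (2 * \<tau> / r) \<le> e"
          unfolding e_def using False r t s by (simp add: divide_left_mono)
        then have "e * (- 2 * H^2) \<le> exp (2 * \<tau> / r) * (- 2 * H^2)"
          by (intro mult_right_mono_neg) auto
        ultimately show ?thesis using False by (simp add: S_def r_def)
      qed
    qed
    have int_F: "set_integrable lborel K F"
      unfolding F_def[abs_def]
      by (rule set_integrable_continuous_compact[OF K(1)])
        (intro continuous_intros continuous_on_sqdist cont_v cont_L cont_Q; use pos in force)
    have int_c: "set_integrable lborel K (\<lambda>x. 2 * H^2)"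
      by (rule set_integrable_continuous_compact[OF K(1)]) (intro continuous_intros)
    have "(LINT x:K|lborel. e * (4 * \<tau>^3 / R^5 * (indicator S x * (v x)^2) - 2 * H^2))
        \<le> (LINT x:K|lborel. F x)"
      by (rule set_integral_mono[OF _ int_F lower])
        (intro set_integrable_mult_right set_integral_diff int_ind int_c)
    moreover have "(LINT x:K|lborel. e * (4 * \<tau>^3 / R^5 * (indicator S x * (v x)^2) - 2 * H^2))
        = e * (4 * \<tau>^3 / R^5 * J - (LINT x:K|lborel. 2 * H^2))"
      using int_ind int_c by (simp add: set_integral_diff)
    ultimately have "e * (4 * \<tau>^3 / R^5 * J - (LINT x:K|lborel. 2 * H^2)) \<le> 0"
      using carl by linarith
    moreover have "(LINT x:K|lborel. 2 * H^2) = C"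
      unfolding C_def using K(1) by (simp add: set_lebesgue_integral_def mult_ac)
    ultimately have "e * (4 * \<tau>^3 / R^5 * J - C) \<le> 0"
      by simp
    then show ?thesis
      using e by (simp add: mult_le_0_iff)
  qed
  have "J \<le> 0"
  proof (rule ccontr)
    assume "\<not> J \<le> 0"
    then have J: "0 < J" by simp
    define \<tau> where "\<tau> = max T (max 1 ((C + 1) * R^5 / (4 * J)))"
    have t: "T \<le> \<tau>" "1 \<le> \<tau>" "(C + 1) * R^5 / (4 * J) \<le> \<tau>" by (auto simp: \<tau>_def)
    have "\<tau>^1 \<le> \<tau>^3" using t by (intro power_increasing) auto
    then have "(C + 1) * R^5 / (4 * J) \<le> \<tau>^3" using t by simp
    then have "C + 1 \<le> 4 * \<tau>^3 / R^5 * J"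
      using J R by (simp add: field_simps)
    with main[OF t(1)] show False by simp
  qed
  with \<open>0 \<le> J\<close> show ?thesis by (simp add: J_def S_def)
qed

text \<open>By continuity, a nonzero value would make \<open>v\<close> nonzero on a nonempty open set, which is not
  negligible.\<close>

lemma set_integral_square_eq_0_imp_eq_0:
  fixes v :: "real^'n \<Rightarrow> real"
  assumes S: "compact S" "continuous_on S v" "(LINT x:S|lborel. (v x)^2) = 0"
    and x: "x \<in> interior S"
  shows "v x = 0"
proof (rule ccontr)
  assume "v x \<noteq> 0"
  define N where "N = interior S \<inter> v -` (- {0})"
  have "open N"
    unfolding N_def
    by (intro continuous_open_preimage continuous_on_subset[OF S(2)] interior_subset open_interior) auto
  moreover have "x \<in> N" using x \<open>v x \<noteq> 0\<close> by (simp add: N_def)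
  ultimately have not_neg: "\<not> negligible N" using open_not_negligible by blast
  have int: "integrable lborel (\<lambda>x. indicator S x *\<^sub>R (v x)^2)"
    using set_integrable_continuous_compact[OF S(1), of "\<lambda>x. (v x)^2"] S(2)
    by (auto simp: set_integrable_def intro!: continuous_intros)
  have "AE x in lborel. indicator S x *\<^sub>R (v x)^2 = 0"
    using integral_nonneg_eq_0_iff_AE[OF int] S(3) by (simp add: set_lebesgue_integral_def)
  then have "AE x in lborel. x \<notin> N"
    by (rule AE_mp) (use interior_subset in \<open>auto simp: N_def indicator_def\<close>)
  then have "N \<in> null_sets lborel"
    using AE_iff_null_sets[of N lborel] \<open>open N\<close> by simp
  then have "negligible N"
    by (simp add: negligible_iff_null_sets null_sets_completionI)
  with not_neg show False by simp
qed

text \<open>Vanishing of \<open>u\<close> near the centre keeps the support of the cut-off function away from the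
  singularity of the weight at \<open>p\<close>. However small that neighbourhood is, the zeros fill the whole ball.\<close>

lemma zero_near_center_imp_zero_on_ball:
  fixes G :: "(real^'n) set" and u :: "real^'n \<Rightarrow> real"
  assumes G: "open G" "cball p R \<subseteq> G" and u: "C2_on G u"
    and ineq: "\<And>x. x \<in> G \<Longrightarrow> \<bar>laplacian u x\<bar> \<le> M * (norm (gradient u x) + \<bar>u x\<bar>)"
    and zero: "0 < r0" "\<And>x. x \<in> ball p r0 \<Longrightarrow> u x = 0"
    and y: "y \<in> ball p R"
  shows "u y = 0"
proof (cases "y \<in> ball p r0")
  case True
  then show ?thesis by (rule zero)
next
  case False
  have sq: "sqdist p x = (dist p x)^2" for x
    by (simp add: sqdist_def power2_norm_eq_inner dist_norm norm_minus_commute flip: power2_norm_eq_inner)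
  have R: "0 < R" using y by (simp) (meson le_less_trans zero_le_dist)
  define U where "U = G - {p}"
  have U: "open U" "p \<notin> U" using G by (auto simp: U_def)
  \<comment> \<open>The level \<open>s\<close> separates the region where the cutoff is bounded below, which contains \<open>y\<close>, from the
    region where it degenerates.\<close>
  obtain s where s: "sqdist p y < s" "s < R^2"
    using dense[of "sqdist p y" "R^2"] y by (auto simp: sq power_strict_mono)
  have s0: "0 < s" using s(1) by (smt (verit) sq zero_le_power2)
  define d where "d = R^2 - s"
  have d: "0 < d" using s by (simp add: d_def)
  define m where "m r = max 0 (R^2 - r)" for r :: real
  define v where "v x = m (sqdist p x)^3 * u x" for x
  define K where "K = {x. r0^2 \<le> sqdist p x \<and> sqdist p x \<le> R^2}"
  have KG: "K \<subseteq> cball p R"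
    using R by (auto simp: K_def sq abs_le_square_iff[symmetric])
  have "closed K"
    unfolding K_def by (intro closed_Collect_conj closed_Collect_le continuous_on_sqdist continuous_on_const)
  then have K: "compact K" "K \<subseteq> U" "\<And>x. x \<in> K \<Longrightarrow> sqdist p x \<le> R^2"
  proof -
    show "compact K"
      using \<open>closed K\<close> KG bounded_subset[OF bounded_cball] compact_eq_bounded_closed by blast
    have "p \<notin> K" using zero(1) by (simp add: K_def sqdist_def)
    then show "K \<subseteq> U" using KG G(2) by (auto simp: U_def)
  qed (simp add: K_def)
  have v0: "v x = 0" if "x \<notin> K" for x
  proof (cases "sqdist p x \<le> R^2")
    case True
    then have "(dist p x)^2 < r0^2" using that by (simp add: K_def sq)
    then have "dist p x < r0" using zero(1) by (simp add: power2_less_imp_less)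
    then show ?thesis using zero(2) by (simp add: v_def)
  qed (simp add: v_def m_def)
  have h: "((\<lambda>r. m r^3) has_real_derivative - 3 * m r^2) (at r)" for r
    using power_positive_part_derivative[of "R^2" 1 r] by (simp add: m_def numeral_eq_Suc)
  have h': "((\<lambda>r. - 3 * m r^2) has_real_derivative 6 * m r) (at r)" for r
    using DERIV_cmult[OF power_positive_part_derivative[of "R^2" 0 r], of "- 3"]
    by (simp add: m_def numeral_eq_Suc)
  have h'': "continuous_on (sqdist p ` U) (\<lambda>r. 6 * m r)"
    unfolding m_def by (intro continuous_intros)
  have uU: "C2_on U u" using C2_on_subset[OF u] by (simp add: U_def)
  have v: "C2_on U v"
    unfolding v_def[abs_def] by (rule C2_on_radial_mult[OF U(1) uU h h' h''])
  define n where "n = real CARD('n)"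
  define M' where "M' = max M 0"
  define A where "A = M' + 12 * R / d"
  define B where "B = A * (6 * R / d) + M' + 24 * R^2 / d^2 + 6 * n / d"
  have bound: "(laplacian v x)^2 \<le> 2 * A^2 * (gradient v x \<bullet> gradient v x) + 2 * B^2 * (v x)^2"
    if x: "x \<in> K" "sqdist p x \<le> s" for x
  proof -
    define r where "r = sqdist p x"
    have xU: "x \<in> U" using K x by blast
    then have xG: "x \<in> G" by (simp add: U_def)
    have r: "0 \<le> r" "r \<le> R^2" using K(3)[OF x(1)] by (auto simp: r_def sq)
    have dm: "d \<le> m r" using x(2) by (simp add: d_def m_def r_def)
    have X: "norm (x - p) \<le> R"
      using KG x(1) by (auto simp: dist_norm norm_minus_commute)
    have grad: "gradient v x = m r^3 *\<^sub>R gradient u x + (2 * (- 3 * m r^2) * u x) *\<^sub>R (x - p)"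
      unfolding v_def[abs_def] r_def by (rule gradient_radial_mult[OF U(1) uU h h' h'' xU])
    have lap: "laplacian v x = m r^3 * laplacian u x - 12 * m r^2 * ((x - p) \<bullet> gradient u x)
        + (24 * r * m r - 6 * n * m r^2) * u x"
      using laplacian_radial_mult[OF U(1) uU h h' h'' xU]
      by (simp add: v_def[abs_def] r_def n_def)
    have "\<bar>laplacian u x\<bar> \<le> M' * (norm (gradient u x) + \<bar>u x\<bar>)"
      using ineq[OF xG] by (rule order_trans) (auto simp: M'_def intro!: mult_right_mono)
    moreover have "\<bar>(x - p) \<bullet> gradient u x\<bar> \<le> R * norm (gradient u x)"
      by (rule order_trans[OF Cauchy_Schwarz_ineq2]) (intro mult_right_mono X norm_ge_zero)
    moreover have "m r^3 * norm (gradient u x) \<le> norm (gradient v x) + 6 * m r^2 * \<bar>u x\<bar> * R"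
    proof -
      have "m r^3 *\<^sub>R gradient u x = gradient v x + (6 * m r^2 * u x) *\<^sub>R (x - p)"
        by (simp add: grad)
      then have "norm (m r^3 *\<^sub>R gradient u x) \<le> norm (gradient v x) + norm ((6 * m r^2 * u x) *\<^sub>R (x - p))"
        by (simp only: norm_triangle_ineq)
      also have "norm ((6 * m r^2 * u x) *\<^sub>R (x - p)) \<le> 6 * m r^2 * \<bar>u x\<bar> * R"
        using X by (simp add: abs_mult mult_left_mono)
      finally show ?thesis by (simp add: m_def)
    qed
    ultimately have "\<bar>laplacian v x\<bar> \<le> A * norm (gradient v x) + B * \<bar>m r^3 * u x\<bar>"
      unfolding lap A_def B_def using d dm r R
      by (intro cutoff_laplacian_bound) (auto simp: n_def M'_def)
    also have "m r^3 * u x = v x" by (simp add: v_def r_def)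
    finally have "\<bar>laplacian v x\<bar>^2 \<le> (A * norm (gradient v x) + B * \<bar>v x\<bar>)^2"
      by (rule power_mono) simp
    also have "\<dots> \<le> 2 * (A * norm (gradient v x))^2 + 2 * (B * \<bar>v x\<bar>)^2"
      using sum_squares_bound[of "A * norm (gradient v x)" "B * \<bar>v x\<bar>"] by (simp add: power2_sum)
    finally show ?thesis
      by (simp add: power_mult_distrib flip: power2_norm_eq_inner)
  qed
  define S where "S = {x \<in> K. sqdist p x \<le> s}"
  have int0: "(LINT x:S|lborel. (v x)^2) = 0"
    unfolding S_def
    by (rule sublevel_integral_eq_0[OF U K v v0 s0 _ bound]) (use R in auto)
  have "closed {x. sqdist p x \<le> s}"
    by (intro closed_Collect_le continuous_on_sqdist continuous_on_const)
  moreover have "S = K \<inter> {x. sqdist p x \<le> s}"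
    by (auto simp: S_def)
  ultimately have S: "compact S"
    using compact_Int_closed[OF K(1)] by auto
  have contv: "continuous_on U v"
    by (intro C1_on_imp_continuous_on C2_on_imp_C1_on v)
  show ?thesis
  proof (rule ccontr)
    assume uy: "u y \<noteq> 0"
    define N where "N = {x \<in> U. v x \<noteq> 0} \<inter> {x. sqdist p x < s}"
    have "open {x \<in> U. v x \<noteq> 0}"
      using continuous_open_preimage[OF contv U(1), of "- {0}"]
      by (rule back_subst[where P = "open"]) auto
    moreover have "open {x. sqdist p x < s}"
      by (intro open_Collect_less continuous_on_sqdist continuous_on_const)
    ultimately have "open N" unfolding N_def by (rule open_Int)
    moreover have "N \<subseteq> S" using v0 by (auto simp: N_def S_def)
    moreover have "v y \<noteq> 0" using uy s by (simp add: v_def m_def)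
    then have "y \<in> N" using v0[of y] K(2) s by (auto simp: N_def)
    ultimately have "y \<in> interior S" by (auto simp: interior_def)
    then have "v y = 0"
      using K(2) by (intro set_integral_square_eq_0_imp_eq_0[OF S _ int0] continuous_on_subset[OF contv])
        (auto simp: S_def)
    with \<open>v y \<noteq> 0\<close> show False by simp
  qed
qed

theorem theorem4p2:
  fixes G D :: "(real^'n) set"
    and b :: "real^'n \<Rightarrow> real^'n"
    and u :: "real^'n \<Rightarrow> real"
  assumes "CARD('n) \<ge> 2"
    and "open G" and "connected G"
    and "\<And>i. continuous_on G (\<lambda>x. b x $ i)"
    and "\<And>i. bounded ((\<lambda>x. b x $ i) ` G)"
    and "C2_on G u"
    and "\<And>x. x \<in> G \<Longrightarrow> laplacian u x = b x \<bullet> gradient u x"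
    and "open D" and "D \<noteq> {}" and "D \<subseteq> G"
    and "\<And>x. x \<in> D \<Longrightarrow> u x = 0"
  shows "\<forall>x\<in>G. u x = 0"
proof -
  have "\<exists>c. \<forall>x\<in>G. \<bar>b x $ i\<bar> \<le> c" for i
    using assms(5)[of i] by (auto simp: bounded_iff)
  then obtain c where c: "\<And>i x. x \<in> G \<Longrightarrow> \<bar>b x $ i\<bar> \<le> c i"
    by metis
  define M where "M = (\<Sum>i\<in>UNIV. c i)"
  have M: "norm (b x) \<le> M" if "x \<in> G" for x
    unfolding M_def by (rule order_trans[OF norm_le_l1_cart]) (intro sum_mono c that)
  have ineq: "\<bar>laplacian u x\<bar> \<le> M * (norm (gradient u x) + \<bar>u x\<bar>)" if x: "x \<in> G" for x
  proof -
    have "\<bar>laplacian u x\<bar> \<le> norm (b x) * norm (gradient u x)"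
      unfolding assms(7)[OF x] by (rule Cauchy_Schwarz_ineq2)
    also have "\<dots> \<le> M * (norm (gradient u x) + \<bar>u x\<bar>)"
      using M[OF x] by (intro mult_mono) (auto intro: order_trans[OF norm_ge_zero])
    finally show ?thesis .
  qed
  \<comment> \<open>A limit of points of \<open>Z\<close> lies in a ball around such a point whose radius depends only on
    the distance to the boundary of \<open>G\<close>, so \<open>Z\<close> is relatively closed.\<close>
  define Z where "Z = G \<inter> interior {x. u x = 0}"
  have "open Z" unfolding Z_def by (intro open_Int open_interior assms(2))
  have "x \<in> Z" if x: "x \<in> G" "x \<in> closure Z" for x
  proof -
    obtain R where R: "0 < R" "ball x R \<subseteq> G"
      using assms(2) x(1) open_contains_ball by blast
    have "0 < R / 3" using R(1) by simp
    then obtain p where p: "p \<in> Z" "dist p x < R / 3"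
      using x(2) unfolding closure_approachable by blast
    obtain r0 where r0: "0 < r0" "ball p r0 \<subseteq> {x. u x = 0}"
      using p(1) unfolding Z_def mem_interior Int_iff by blast
    have "cball p (R / 2) \<subseteq> G"
    proof
      fix z assume "z \<in> cball p (R / 2)"
      then have "dist x z < R"
        using p(2) R(1) dist_triangle[of x z p] by (simp add: dist_commute)
      then show "z \<in> G" using R(2) by auto
    qed
    moreover have "\<And>z. z \<in> ball p r0 \<Longrightarrow> u z = 0" using r0(2) by blast
    ultimately have "u z = 0" if "z \<in> ball p (R / 2)" for z
      using zero_near_center_imp_zero_on_ball[OF assms(2) _ assms(6) ineq r0(1) _ that] by blast
    then have "ball p (R / 2) \<subseteq> {x. u x = 0}" by blast
    moreover have "x \<in> ball p (R / 2)" using p(2) R(1) by simp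
    ultimately have "x \<in> interior {x. u x = 0}"
      by (metis interiorI open_ball)
    then show ?thesis using x(1) by (simp add: Z_def)
  qed
  then have "G \<inter> closure Z = Z"
    using closure_subset[of Z] by (auto simp: Z_def)
  then have "closedin (top_of_set G) Z"
    by (metis closed_closure closedin_closed_Int)
  moreover have "openin (top_of_set G) Z"
    using \<open>open Z\<close> by (intro open_openin_trans) (auto simp: Z_def assms(2))
  moreover have "Z \<noteq> {}"
  proof -
    have "D \<subseteq> interior {x. u x = 0}"
      using assms(8,11) by (intro interior_maximal) auto
    then show ?thesis using assms(9,10) by (auto simp: Z_def)
  qed
  ultimately have "Z = G"
    using assms(3) connected_clopen by blast
  then show ?thesis
    using interior_subset by (auto simp: Z_def)
qed

end
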